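(* Let $p$ be an odd prime, $q$ a power of $p$, $\ell$ an odd prime with $\ell\ne p$, and $m,n$ positive integers. Let $f=\mathrm{ord}_\ell(q)$. (i) If $f$ is odd, then the LCD cyclic codes of length $2\ell^mp^n$ over $\mathbb F_q$ are exactly the codes generated by $$(X-1)^{\varepsilon_0}(X+1)^{\epsilon_0}\prod_{r=1}^{m}\prod_{k=0}^{\frac{\delta(r)}{2}-1}M_{\ell^{m-r}g^k}(X)^{\varepsilon_k^r}M_{-\ell^{m-r}g^k}(X)^{\varepsilon_k^r}\hat M_{\ell^{m-r}g^k}(-X)^{\sigma_k^r}\hat M_{-\ell^{m-r}g^k}(-X)^{\sigma_k^r},$$ with $\varepsilon_0,\epsilon_0,\varepsilon_k^r,\sigma_k^r\in\{0,p^n\}$, and there are exactly $2^{e+2}$ of them. (ii) If $f$ is even, then the LCD cyclic codes of length $2\ell^mp^n$ over $\mathbb F_q$ are exactly the codes generated by $$\prod_{i=0}^{e}\hat M_{\rho_i}(X)^{\varepsilon_i}\hat M_{\rho_i}(-X)^{\epsilon_i},\qquad \varepsilon_i,\epsilon_i\in\{0,p^n\},$$ and there are exactly $2^{2(e+1)}$ of them.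
   Context: A cyclic code of length $N$ over $\mathbb F_q$ is an ideal of $\mathbb F_q[X]/\langle X^N-1\rangle$; the code generated by $g(X)$ is the ideal generated by its image. A linear code $C$ is LCD (linear complementary dual) if $C\cap C^\perp=\{0\}$, where $C^\perp$ is the Euclidean dual. For a nonzero polynomial $h$ with leading coefficient $c$, $\hat h=c^{-1}h$. For an integer $t$, $C_t=\{tq^i\bmod\ell^m:i\ge0\}$ is the $q$-cyclotomic coset of $t$ modulo $\ell^m$; $\rho_0=0,\rho_1,\dots,\rho_e$ are representatives of all distinct $q$-cyclotomic cosets modulo $\ell^m$ (so there are $e+1$ cosets). $\eta$ is a primitive $\ell^m$-th root of unity in an extension of $\mathbb F_q$, and $M_t(X)=\prod_{s\in C_t}(X-\eta^s)$ is the minimal polynomial of $\eta^t$ over $\mathbb F_q$. $g$ is a fixed generator of $\mathbb Z_{\ell^m}^*$, $\lambda(r)=\mathrm{ord}_{\ell^r}(q)$ and $\delta(r)=\phi(\ell^r)/\lambda(r)$ for $1\le r\le m$ ($\phi$ Euler's function). *)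

theory Defs
  imports "HOL-Number_Theory.Number_Theory" "HOL-Computational_Algebra.Polynomial"
begin

text \<open>Cyclic codes of length N over a field, viewed inside F[X]/(X^N-1), whose
  elements are represented by their unique residues of degree < N.\<close>

definition xn1 :: "nat \<Rightarrow> 'a::field poly" where
  "xn1 N = monom 1 N - 1"

definition cyclic_code :: "nat \<Rightarrow> 'a::field poly set \<Rightarrow> bool" where
  "cyclic_code N C \<longleftrightarrow> C \<subseteq> {c. degree c < N} \<and> 0 \<in> C
     \<and> (\<forall>c\<in>C. \<forall>d\<in>C. c + d \<in> C)
     \<and> (\<forall>a. \<forall>c\<in>C. (a * c) mod xn1 N \<in> C)"

definition code_gen :: "nat \<Rightarrow> 'a::field poly \<Rightarrow> 'a poly set" where
  "code_gen N g = {(a * g) mod xn1 N | a. True}"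

definition dual_code :: "nat \<Rightarrow> 'a::field poly set \<Rightarrow> 'a poly set" where
  "dual_code N C = {d. degree d < N \<and> (\<forall>c\<in>C. (\<Sum>i<N. coeff c i * coeff d i) = 0)}"

definition LCD :: "nat \<Rightarrow> 'a::field poly set \<Rightarrow> bool" where
  "LCD N C \<longleftrightarrow> C \<inter> dual_code N C = {0}"

definition hatp :: "'a::field poly \<Rightarrow> 'a poly" where
  "hatp h = smult (inverse (lead_coeff h)) h"

definition negX :: "'a::field poly \<Rightarrow> 'a poly" where
  "negX h = pcompose h [:0, -1:]"

definition cyclo_coset :: "nat \<Rightarrow> nat \<Rightarrow> int \<Rightarrow> nat set" where
  "cyclo_coset q n t = {nat ((t * int q ^ i) mod int n) | i. True}"

text \<open>Minimal polynomial M_t(X) = prod_{s in C_t} (X - eta^s) of eta^t over F_q,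
  where F_q (type 'a) is embedded into the extension field 'b via emb:
  the unique polynomial over 'a whose image under emb is that product.\<close>
definition minpoly_M :: "('a::field \<Rightarrow> 'b::field) \<Rightarrow> 'b \<Rightarrow> nat \<Rightarrow> nat \<Rightarrow> int \<Rightarrow> 'a poly" where
  "minpoly_M emb \<eta> q n t =
     (THE P. map_poly emb P = (\<Prod>s\<in>cyclo_coset q n t. [:- (\<eta> ^ s), 1:]))"

end

theory Submission
  imports Defs
begin

text \<open>
  Put \<open>P = p ^ n\<close> and \<open>N = 2 * l ^ m * P\<close>. Over the extension field, $X^N - 1$ is the \<open>P\<close>-th
  power of $\prod_{z \in U} (X - z)$, where \<open>U\<close> consists of the elements $\pm\eta^t$. A cyclic code
  is the set of multiples of a divisor \<open>d\<close> of $X^N - 1$, and with $d h = X^N - 1$ its dual is the set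
  of multiples of the reciprocal of \<open>h\<close>. Hence the code is LCD iff, for every \<open>z\<close> in \<open>U\<close>, the
  multiplicity of \<open>z\<close> in \<open>d\<close> is \<open>P\<close> or that of \<open>inverse z\<close> is \<open>0\<close>. Applying this to \<open>z\<close> and to
  \<open>inverse z\<close> shows that all multiplicities are \<open>0\<close> or \<open>P\<close>, so that LCD codes correspond to the
  subsets of \<open>U\<close> stable under $z \mapsto z^q$ and inversion. It remains to list the orbits: if \<open>f\<close> is
  even then $-1$ is a power of \<open>q\<close> modulo $l^m$ and inversion preserves every \<open>q\<close>-cyclotomic coset;
  if \<open>f\<close> is odd it pairs every nonzero coset with a different one, and since $-1 = g^{\phi(l^r)/2}$
  lies in $g^{\delta(r)/2} \langle q \rangle$, the elements $\pm l^{m-r} g^k$ with $k < \delta(r)/2$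
  represent all nonzero cosets.
\<close>

section \<open>Cyclic codes as multiples of a divisor of $X^N - 1$\<close>

lemma degree_xn1: "N > 0 \<Longrightarrow> degree (xn1 N :: 'a::field poly) = N"
proof -
  assume "N > 0"
  hence "degree (monom 1 N + (-1) :: 'a poly) = degree (monom 1 N :: 'a poly)"
    by (intro degree_add_eq_left) (auto simp: degree_monom_eq)
  thus ?thesis by (simp add: xn1_def degree_monom_eq)
qed

lemma xn1_neq_0: "N > 0 \<Longrightarrow> xn1 N \<noteq> (0 :: 'a::field poly)"
  using degree_xn1[of N, where 'a='a] by auto

lemma degree_mod_xn1: "N > 0 \<Longrightarrow> degree (c mod xn1 N :: 'a::field poly) < N"
  using degree_mod_less[OF xn1_neq_0, of N c] degree_xn1[of N, where 'a='a] by auto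

lemma mod_xn1_id: "N > 0 \<Longrightarrow> degree c < N \<Longrightarrow> c mod xn1 N = (c :: 'a::field poly)"
  by (simp add: mod_poly_less degree_xn1)

lemma reflect_xn1: "N > 0 \<Longrightarrow> reflect_poly (xn1 N) = - (xn1 N :: 'a::field poly)"
  by (rule poly_eqI) (auto simp: coeff_reflect_poly degree_xn1, auto simp: xn1_def)

text \<open>The normal form of a cyclic code: when \<open>d\<close> divides \<open>xn1 N\<close>,
  membership is plain divisibility, with no reduction modulo \<open>xn1 N\<close>.\<close>

definition mult_code :: "nat \<Rightarrow> 'a::field poly \<Rightarrow> 'a poly set" where
  "mult_code N d = {c. degree c < N \<and> d dvd c}"

lemma code_gen_eq_mult_code:
  fixes d :: "'a::field poly"
  assumes "N > 0" "d dvd xn1 N"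
  shows "code_gen N d = mult_code N d"
proof (intro equalityI subsetI)
  fix c assume "c \<in> code_gen N d"
  thus "c \<in> mult_code N d"
    using assms by (auto simp: code_gen_def mult_code_def degree_mod_xn1 dvd_mod)
next
  fix c assume "c \<in> mult_code N d"
  hence deg: "degree c < N" and "d dvd c" by (auto simp: mult_code_def)
  then obtain k where "c = k * d" by (metis dvdE mult.commute)
  with deg have "c = (k * d) mod xn1 N"
    using assms by (metis mod_xn1_id)
  thus "c \<in> code_gen N d" by (auto simp: code_gen_def)
qed

lemma cyclic_code_mult_code:
  fixes d :: "'a::field poly"
  assumes "N > 0" "d dvd xn1 N"
  shows "cyclic_code N (mult_code N d)"
  using assms degree_add_less
  by (auto simp: cyclic_code_def mult_code_def degree_mod_xn1 dvd_mod)

text \<open>The generator is an element of least degree in the preimage ideal of \<open>C\<close>.\<close>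
lemma cyclic_code_principal:
  fixes C :: "'a::field poly set"
  assumes N: "N > 0" and C: "cyclic_code N C"
  obtains d where "d dvd xn1 N" "C = mult_code N d"
proof -
  define J where "J = {c. c mod xn1 N \<in> C}"
  have deg: "c \<in> C \<Longrightarrow> degree c < N" for c using C by (auto simp: cyclic_code_def)
  have C0: "0 \<in> C" using C by (auto simp: cyclic_code_def)
  have J_add: "x + y \<in> J" if "x \<in> J" "y \<in> J" for x y
    using that C by (auto simp: J_def cyclic_code_def poly_mod_add_left)
  have J_mult: "a * x \<in> J" if "x \<in> J" for a x
  proof -
    have "(a * (x mod xn1 N)) mod xn1 N \<in> C" using that C by (auto simp: J_def cyclic_code_def)
    thus ?thesis by (simp add: J_def mod_mult_right_eq)
  qed
  have xJ: "xn1 N \<in> J \<and> xn1 N \<noteq> (0::'a poly)" using C0 xn1_neq_0[OF N] by (auto simp: J_def)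
  define d where "d = arg_min degree (\<lambda>c. c \<in> J \<and> c \<noteq> 0)"
  have d: "d \<in> J \<and> d \<noteq> 0" unfolding d_def by (rule arg_min_natI[where k = "xn1 N"]) (rule xJ)
  have min: "degree d \<le> degree c" if "c \<in> J" "c \<noteq> 0" for c
    unfolding d_def using arg_min_nat_le[of "\<lambda>c. c \<in> J \<and> c \<noteq> 0" c degree] that by auto
  have dvd: "d dvd c" if "c \<in> J" for c
  proof (rule ccontr)
    assume "\<not> d dvd c"
    hence nz: "c mod d \<noteq> 0" by (simp add: dvd_eq_mod_eq_0)
    have "c mod d = c + (- (c div d)) * d"
      by (simp add: minus_div_mult_eq_mod[symmetric])
    hence "c mod d \<in> J" using that d J_add J_mult by metis
    from min[OF this nz] degree_mod_less'[OF _ nz] d show False by auto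
  qed
  have "C = mult_code N d"
  proof (intro equalityI subsetI)
    fix c assume "c \<in> C"
    thus "c \<in> mult_code N d"
      using deg[of c] dvd[of c] mod_xn1_id[OF N, of c] by (auto simp: mult_code_def J_def)
  next
    fix c assume c: "c \<in> mult_code N d"
    then obtain k where "c = k * d" by (metis dvdE mult.commute mult_code_def mem_Collect_eq)
    hence "c \<in> J" using J_mult d by blast
    thus "c \<in> C" using c mod_xn1_id[OF N, of c] by (auto simp: mult_code_def J_def)
  qed
  with dvd xJ that show ?thesis by blast
qed

lemma mult_code_subset_imp_dvd:
  fixes d d' :: "'a::field poly"
  assumes N: "N > 0" and d: "d dvd xn1 N" and d': "d' dvd xn1 N"
    and "mult_code N d \<subseteq> mult_code N d'"
  shows "d' dvd d"
proof -
  \<comment> \<open>The residue is used because \<open>d\<close> itself may have degree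
    \<open>N\<close>; it is then associated with \<open>xn1 N\<close>, its residue is 0, and the
    code is zero.\<close>
  have "d mod xn1 N \<in> mult_code N d"
    using N d by (auto simp: mult_code_def degree_mod_xn1 dvd_mod)
  hence "d' dvd d mod xn1 N" using assms(4) by (auto simp: mult_code_def)
  thus ?thesis using d' by (simp add: dvd_mod_iff)
qed

text \<open>For \<open>degree b < N\<close> this is $X^{N-1} b(1/X)$.\<close>
definition reverse_poly :: "nat \<Rightarrow> 'a::field poly \<Rightarrow> 'a poly" where
  "reverse_poly N b = monom 1 (N - 1 - degree b) * reflect_poly b"

lemma coeff_reverse_poly:
  "degree b < N \<Longrightarrow> coeff (reverse_poly N b) i = (if i < N then coeff b (N - 1 - i) else 0)"
proof -
  assume b: "degree b < N"
  have "coeff b (N - 1 - i) = 0" if "i < N - 1 - degree b"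
    using that by (intro coeff_eq_0) auto
  moreover have "degree b - (i - (N - 1 - degree b)) = N - 1 - i"
    if "\<not> i < N - 1 - degree b" "i < N" using that b by auto
  ultimately show ?thesis using b
    by (auto simp: reverse_poly_def coeff_monom_mult coeff_reflect_poly)
qed

lemma degree_reverse_poly: "degree b < N \<Longrightarrow> degree (reverse_poly N b) < N"
  by (metis coeff_reverse_poly leading_coeff_0_iff less_nat_zero_code degree_0 neq0_conv)

lemma reverse_poly_reverse_poly:
  "degree b < N \<Longrightarrow> reverse_poly N (reverse_poly N b) = b"
  by (rule poly_eqI) (auto simp: coeff_reverse_poly degree_reverse_poly coeff_eq_0)

text \<open>Reversal is an involution and \<open>reflect_poly\<close> is multiplicative, so
  reversing a factorization of the reversed word exhibits the reflected factor in
  \<open>b\<close>.\<close>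

lemma dvd_reverse_polyD:
  assumes "degree b < N" "h dvd reverse_poly N b"
  shows "reflect_poly h dvd b"
proof -
  obtain k where k: "reverse_poly N b = h * k" using assms by (auto elim: dvdE)
  have "b = reverse_poly N (h * k)"
    using reverse_poly_reverse_poly[OF assms(1)] k by simp
  thus ?thesis by (simp add: reverse_poly_def reflect_poly_mult)
qed

text \<open>In the convolution at index \<open>N - 1\<close>, coefficient \<open>i\<close> of
  \<open>c\<close> meets coefficient \<open>N - 1 - i\<close> of the reversed word, which is
  coefficient \<open>i\<close> of \<open>b\<close>. Orthogonality thus concerns a single coefficient
  of a product.\<close>

lemma inner_eq_coeff_mult_reverse:
  fixes b c :: "'a::field poly"
  assumes "N > 0" "degree b < N"
  shows "(\<Sum>i<N. coeff c i * coeff b i) = coeff (c * reverse_poly N b) (N - 1)"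
proof -
  have "{..N - 1} = {..<N}" using assms by auto
  thus ?thesis using assms
    by (auto simp: coeff_mult coeff_reverse_poly intro!: sum.cong)
qed

text \<open>Reduction adds up the coefficients of X^(N-1), X^(2N-1), ... at position
  \<open>N - 1\<close>, and the degree bound leaves only the first. Products of two polynomials of
  degree below \<open>N\<close> satisfy the bound.\<close>

lemma coeff_mod_xn1_last:
  fixes u :: "'a::field poly"
  assumes N: "N > 0" and u: "degree u < 2 * N - 1"
  shows "coeff (u mod xn1 N) (N - 1) = coeff u (N - 1)"
proof -
  define w where "w = u div xn1 N"
  have uw: "u = w * xn1 N + u mod xn1 N" by (simp add: w_def)
  have "coeff w (N - 1) = 0"
  proof (cases "w = 0")
    case False
    have "degree (w * xn1 N) \<le> max (degree u) (degree (u mod xn1 N))"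
      using degree_diff_le_max[of u "u mod xn1 N"] by (simp add: w_def minus_mod_eq_div_mult)
    moreover have "degree (w * xn1 N) = degree w + N"
      using False N by (simp add: degree_mult_eq xn1_neq_0 degree_xn1)
    ultimately have "degree w < N - 1" using u degree_mod_xn1[OF N, of u] by auto
    thus ?thesis by (rule coeff_eq_0)
  qed simp
  moreover have "w * xn1 N = monom 1 N * w - w" by (simp add: xn1_def algebra_simps)
  ultimately have "coeff (w * xn1 N) (N - 1) = 0" using N by (simp add: coeff_monom_mult)
  thus ?thesis by (subst (2) uw) simp
qed

text \<open>Multiplying by the powers of \<open>X\<close> moves every coefficient of \<open>d * reverse_poly N b\<close> modulo
  \<open>xn1 N\<close> to the top position, where it is an inner product with a codeword.\<close>
lemma dual_code_mult_code:
  fixes d h :: "'a::field poly"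
  assumes N: "N > 0" and dh: "d * h = xn1 N"
  shows "dual_code N (mult_code N d) = {b. degree b < N \<and> h dvd reverse_poly N b}"
proof -
  have d0: "d \<noteq> 0" using dh xn1_neq_0[OF N, where 'a='a] by auto
  have "(\<forall>c\<in>mult_code N d. (\<Sum>i<N. coeff c i * coeff b i) = 0) \<longleftrightarrow> h dvd reverse_poly N b"
    if b: "degree b < N" for b
  proof -
    let ?b = "reverse_poly N b"
    have deg: "degree (c * ?b) < 2 * N - 1" if "degree c < N" for c
      using degree_mult_le[of c ?b] that degree_reverse_poly[OF b] by linarith
    show ?thesis
    proof
      assume "h dvd ?b"
      show "\<forall>c\<in>mult_code N d. (\<Sum>i<N. coeff c i * coeff b i) = 0"
      proof
        fix c assume c: "c \<in> mult_code N d"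
        have "d * h dvd c * ?b" using c \<open>h dvd ?b\<close> by (auto simp: mult_code_def mult_dvd_mono)
        hence "(c * ?b) mod xn1 N = 0" by (simp add: dh)
        thus "(\<Sum>i<N. coeff c i * coeff b i) = 0"
          using coeff_mod_xn1_last[OF N deg, of c] c inner_eq_coeff_mult_reverse[OF N b]
          by (simp add: mult_code_def)
      qed
    next
      assume orth: "\<forall>c\<in>mult_code N d. (\<Sum>i<N. coeff c i * coeff b i) = 0"
      define w where "w = (d * ?b) mod xn1 N"
      have degw: "degree w < N" using degree_mod_xn1[OF N] by (simp add: w_def)
      have "coeff w j = 0" for j
      proof (cases "j < N")
        case True
        define k where "k = N - 1 - j"
        define c where "c = (monom 1 k * d) mod xn1 N"
        have "d dvd xn1 N" using dh by (metis dvd_triv_left)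
        hence c: "c \<in> mult_code N d"
          using N by (auto simp: c_def mult_code_def degree_mod_xn1 dvd_mod)
        have "0 = coeff (c * ?b) (N - 1)"
          using orth c inner_eq_coeff_mult_reverse[OF N b] by simp
        also have "\<dots> = coeff ((c * ?b) mod xn1 N) (N - 1)"
          using coeff_mod_xn1_last[OF N deg, of c] c by (simp add: mult_code_def)
        also have "(c * ?b) mod xn1 N = (monom 1 k * w) mod xn1 N"
          by (simp add: c_def w_def mod_mult_left_eq mod_mult_right_eq mult.assoc)
        also have "coeff \<dots> (N - 1) = coeff (monom 1 k * w) (N - 1)"
        proof (rule coeff_mod_xn1_last[OF N])
          have "degree (monom 1 k * w) \<le> k + degree w"
            using degree_mult_le[of "monom 1 k" w] degree_monom_le[of "1::'a" k] by linarith
          thus "degree (monom 1 k * w) < 2 * N - 1" using degw True by (auto simp: k_def)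
        qed
        also have "\<dots> = coeff w j" using True N by (simp add: coeff_monom_mult k_def)
        finally show ?thesis ..
      qed (use degw in \<open>auto intro: coeff_eq_0\<close>)
      hence "w = 0" by (simp add: poly_eq_iff)
      hence "d * h dvd d * ?b" by (simp add: dh w_def mod_eq_0_iff_dvd)
      thus "h dvd ?b" using d0 by simp
    qed
  qed
  thus ?thesis by (auto simp: dual_code_def)
qed

lemma LCD_mult_code_iff:
  fixes d h :: "'a::field poly"
  assumes "N > 0" "d * h = xn1 N"
  shows "LCD N (mult_code N d) \<longleftrightarrow>
    (\<forall>b. degree b < N \<longrightarrow> d dvd b \<longrightarrow> h dvd reverse_poly N b \<longrightarrow> b = 0)"
  using assms(1) unfolding LCD_def dual_code_mult_code[OF assms]
  by (auto simp: mult_code_def reverse_poly_def)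

section \<open>Descent along the embedding\<close>

text \<open>Stated for an arbitrary ring map, since it serves both \<open>emb\<close> and the
  Frobenius power map of the extension.\<close>

lemma map_poly_hom_mult:
  fixes h :: "'a::comm_ring_1 \<Rightarrow> 'b::comm_ring_1"
  assumes "h 0 = 0" "\<And>x y. h (x + y) = h x + h y" "\<And>x y. h (x * y) = h x * h y"
  shows "map_poly h (a * b) = map_poly h a * map_poly h b"
proof -
  have "h (sum f A) = (\<Sum>x\<in>A. h (f x))" if "finite A" for f and A :: "nat set"
    using that by (induction A) (auto simp: assms)
  thus ?thesis by (intro poly_eqI) (simp add: coeff_map_poly coeff_mult assms)
qed

lemma map_poly_hom_prod:
  fixes h :: "'a::comm_ring_1 \<Rightarrow> 'b::comm_ring_1"
  assumes "h 0 = 0" "h 1 = 1" "\<And>x y. h (x + y) = h x + h y" "\<And>x y. h (x * y) = h x * h y"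
  shows "map_poly h (\<Prod>x\<in>A. f x) = (\<Prod>x\<in>A. map_poly h (f x))"
  by (induction A rule: infinite_finite_induct) (simp_all add: assms map_poly_hom_mult)

lemma map_poly_hom_power:
  fixes h :: "'a::comm_ring_1 \<Rightarrow> 'b::comm_ring_1"
  assumes "h 0 = 0" "h 1 = 1" "\<And>x y. h (x + y) = h x + h y" "\<And>x y. h (x * y) = h x * h y"
  shows "map_poly h (f ^ k) = map_poly h f ^ k"
  by (induction k) (simp_all add: assms map_poly_hom_mult)

text \<open>Multiplication by a nonzero \<open>x\<close> permutes the nonzero elements; comparing
  the two products of all of them gives Fermat's little theorem for the field.\<close>

lemma power_card_finite_field:
  fixes x :: "'a::{field,finite}"
  shows "x ^ card (UNIV :: 'a set) = x"
proof (cases "x = 0")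
  case False
  let ?c = "card (UNIV - {0} :: 'a set)"
  have "(\<Prod>y\<in>UNIV-{0}. x * y) = (\<Prod>y\<in>UNIV-{0}. y)"
    by (rule prod.reindex_bij_witness[of _ "\<lambda>y. y / x" "\<lambda>y. x * y"]) (use False in auto)
  hence "x ^ ?c * (\<Prod>y\<in>UNIV-{0}. y) = (\<Prod>y\<in>UNIV-{0}. y)" by (simp add: prod.distrib)
  hence "x ^ ?c = 1" by simp
  moreover have "card (UNIV :: 'a set) = Suc ?c"
    by (metis UNIV_I card_Suc_Diff1 finite_class.finite_UNIV)
  ultimately show ?thesis by (metis power_Suc mult_1_right)
qed (simp add: finite_UNIV_card_ge_0)

section \<open>Products of linear factors over a set of roots\<close>

definition root_poly :: "'b::field set \<Rightarrow> 'b poly" where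
  "root_poly S = (\<Prod>z\<in>S. [:- z, 1:])"

lemma root_poly_neq_0 [simp]: "root_poly S \<noteq> 0"
  by (cases "finite S") (auto simp: root_poly_def)

lemma lead_coeff_root_poly: "lead_coeff (root_poly S) = 1"
  by (simp add: root_poly_def lead_coeff_prod)

lemma degree_root_poly: "degree (root_poly S) = card S"
  by (cases "finite S") (auto simp: root_poly_def degree_prod_eq_sum_degree)

lemma poly_root_poly: "finite S \<Longrightarrow> poly (root_poly S) w = 0 \<longleftrightarrow> w \<in> S"
  by (auto simp: root_poly_def poly_prod)

lemma root_poly_Un:
  "finite A \<Longrightarrow> finite B \<Longrightarrow> A \<inter> B = {} \<Longrightarrow> root_poly (A \<union> B) = root_poly A * root_poly B"
  by (simp add: root_poly_def prod.union_disjoint)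

lemma linear_dvd_root_poly: "finite S \<Longrightarrow> z \<in> S \<Longrightarrow> [:- z, 1:] dvd root_poly S"
  unfolding root_poly_def by (rule dvd_prodI)

text \<open>Distinct linear factors are coprime: a new \<open>z\<close> is not a root of the product
  over \<open>S\<close>, so its whole multiplicity falls on the cofactor.\<close>

lemma root_poly_power_dvd:
  assumes "finite S" "\<And>z. z \<in> S \<Longrightarrow> [:- z, 1:] ^ k dvd u"
  shows "root_poly S ^ k dvd u"
  using assms
proof (induction S)
  case empty
  thus ?case by (simp add: root_poly_def)
next
  case (insert z S)
  then obtain w where w: "u = root_poly S ^ k * w" by (auto elim: dvdE)
  have "order z (root_poly S ^ k) = 0"
    by (rule order_0I) (use insert in \<open>simp add: poly_root_poly\<close>)
  hence "[:- z, 1:] ^ k dvd w"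
    using insert.prems[of z] by (cases "u = 0") (auto simp: w order_divides order_mult)
  moreover have "root_poly (insert z S) = root_poly S * [:- z, 1:]"
    using insert by (simp add: root_poly_def mult.commute)
  ultimately show ?case by (simp only: w power_mult_distrib) (rule mult_dvd_mono, simp_all)
qed

lemma reflect_linear:
  fixes z :: "'a::field"
  assumes "z \<noteq> 0"
  shows "reflect_poly [:- z, 1:] = smult (- z) [:- inverse z, 1:]"
  using assms by (simp add: reflect_poly_pCons' monom_Suc monom_0)

section \<open>A finite field embedded in an extension field\<close>

locale finite_field_embedding =
  fixes emb :: "'a::{field,finite} \<Rightarrow> 'b::field" and p s :: nat
  assumes p_prime: "prime p" and s_pos: "s > 0" and card_F: "card (UNIV :: 'a set) = p ^ s"
    and emb_hom: "emb 0 = 0" "emb 1 = 1" "\<And>x y. emb (x + y) = emb x + emb y"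
      "\<And>x y. emb (x * y) = emb x * emb y"
begin

abbreviation "q \<equiv> p ^ s"
abbreviation "E \<equiv> map_poly emb"

lemma emb_eq_0_iff [simp]: "emb x = 0 \<longleftrightarrow> x = 0"
proof
  assume "emb x = 0"
  hence "emb (x * inverse x) = 0" using emb_hom by simp
  thus "x = 0" using emb_hom by (cases "x = 0") auto
qed (use emb_hom in simp)

lemma emb_diff: "emb (x - y) = emb x - emb y"
  using emb_hom(3)[of "x - y" y] by (simp add: algebra_simps)

lemma emb_uminus: "emb (- x) = - emb x"
  using emb_diff[of 0 x] emb_hom by simp

lemma inj_emb: "inj emb"
  by (rule injI) (metis emb_diff emb_eq_0_iff eq_iff_diff_eq_0)

lemma E_mult: "E (a * b) = E a * E b"
  by (rule map_poly_hom_mult) (simp_all add: emb_hom)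

lemma E_prod: "E (\<Prod>x\<in>A. f x) = (\<Prod>x\<in>A. E (f x))"
  by (rule map_poly_hom_prod) (simp_all add: emb_hom)

lemma E_power: "E (a ^ k) = E a ^ k"
  by (rule map_poly_hom_power) (simp_all add: emb_hom)

lemma E_smult: "E (smult c a) = smult (emb c) (E a)"
  by (rule map_poly_smult) (simp_all add: emb_hom)

lemma E_eq_0_iff [simp]: "E a = 0 \<longleftrightarrow> a = 0"
  by (rule map_poly_eq_0_iff) (simp_all add: emb_hom)

lemma degree_E [simp]: "degree (E a) = degree a"
  by (rule degree_map_poly) simp

lemma inj_E: "inj E"
proof (rule injI)
  fix a b assume "E a = E b"
  hence "emb (coeff a i) = emb (coeff b i)" for i
    by (metis coeff_map_poly emb_hom(1))
  thus "a = b" by (intro poly_eqI) (metis inj_emb injD)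
qed

lemma E_reflect: "E (reflect_poly a) = reflect_poly (E a)"
  by (rule poly_eqI) (simp add: coeff_map_poly coeff_reflect_poly emb_hom)

text \<open>Division with remainder is transported by \<open>E\<close>, which preserves degrees, so
  a nonzero remainder would have too small a degree to be divisible by \<open>E a\<close>.\<close>

lemma E_dvd_iff: "E a dvd E b \<longleftrightarrow> a dvd b"
proof
  assume ab: "E a dvd E b"
  show "a dvd b"
  proof (cases "a = 0")
    case False
    have "E b = E a * E (b div a) + E (b mod a)"
    proof -
      have "E (x + y) = E x + E y" for x y
        by (rule poly_eqI) (simp add: coeff_map_poly emb_hom)
      thus ?thesis by (metis E_mult mult_div_mod_eq)
    qed
    hence "E a dvd E (b mod a)" using ab by (metis dvd_add_right_iff dvd_triv_left)
    hence "b mod a = 0"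
      using dvd_imp_degree_le[of "E a" "E (b mod a)"] degree_mod_less[OF False, of b] by force
    thus ?thesis by (simp add: dvd_eq_mod_eq_0)
  qed (use ab in auto)
next
  assume "a dvd b"
  thus "E a dvd E b" by (auto simp: E_mult elim!: dvdE)
qed

lemma E_xn1: "E (xn1 N) = xn1 N"
  by (rule poly_eqI) (auto simp: xn1_def coeff_map_poly emb_hom emb_diff)

text \<open>The characteristic of \<open>'a\<close> is a prime dividing \<open>p ^ s\<close>; the
  relation p = 0 is then carried to \<open>'b\<close> by \<open>emb\<close>.\<close>

lemma CHAR_b: "CHAR('b) = p"
proof -
  have "CHAR('a) dvd p ^ s" using CHAR_dvd_CARD[where 'a='a] card_F by simp
  moreover have "prime CHAR('a)"
    using finite_imp_CHAR_pos[where 'a='a] prime_CHAR_semidom[where 'a='a] by simp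
  ultimately have "CHAR('a) = p"
    using p_prime by (metis prime_dvd_power primes_dvd_imp_eq)
  hence "of_nat p = (0::'a)" by auto
  moreover have "emb (of_nat k) = of_nat k" for k
    by (induction k) (simp_all add: emb_hom)
  ultimately have "of_nat p = (0::'b)" by (metis emb_hom(1))
  hence "CHAR('b) dvd p" by (simp add: of_nat_eq_0_iff_char_dvd)
  thus ?thesis using p_prime CHAR_not_1[where 'a='b] by (auto simp: prime_nat_iff)
qed

section \<open>The Frobenius map and descent to the small field\<close>

lemma frob_add: "(x + y :: 'b) ^ (p ^ k) = x ^ (p ^ k) + y ^ (p ^ k)"
  by (rule freshmans_dream') (simp_all add: CHAR_b p_prime)

lemma p_pow_pos: "p ^ k > 0"
  using p_prime by (simp add: prime_gt_0_nat)

lemma frob_minus: "(- x :: 'b) ^ (p ^ k) = - (x ^ (p ^ k))"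
proof -
  have "x ^ (p ^ k) + (- x) ^ (p ^ k) = 0"
    unfolding frob_add[symmetric] using p_pow_pos[of k] by simp
  thus ?thesis by (simp add: eq_neg_iff_add_eq_0 add.commute)
qed

lemma emb_power: "emb (x ^ k) = emb x ^ k"
  by (induction k) (simp_all add: emb_hom)

lemma emb_frob: "emb x ^ q = emb x"
  by (metis emb_power power_card_finite_field card_F)

text \<open>The polynomial X^q - X has at most \<open>q\<close> roots, and the image of
  \<open>emb\<close> already supplies \<open>q\<close> of them.\<close>

lemma frob_fixed_in_range:
  assumes "c ^ q = c"
  shows "c \<in> range emb"
proof -
  let ?f = "monom 1 q - monom 1 1 :: 'b poly"
  have q1: "q > 1" using one_less_power[OF prime_gt_1_nat[OF p_prime] s_pos] .
  have "coeff ?f q = 1" using q1 by simp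
  hence nz: "?f \<noteq> 0" by (metis coeff_0 zero_neq_one)
  have "degree ?f \<le> q" using q1 by (intro degree_diff_le) (auto simp: degree_monom_eq)
  hence "card {x. poly ?f x = 0} \<le> q" using card_poly_roots_bound[OF nz] by simp
  moreover have "card (range emb) = q" using card_image[OF inj_emb] card_F by simp
  moreover have "range emb \<subseteq> {x. poly ?f x = 0}" by (auto simp: poly_monom emb_frob)
  ultimately have "range emb = {x. poly ?f x = 0}"
    by (intro card_seteq poly_roots_finite[OF nz]) auto
  thus ?thesis using assms by (auto simp: poly_monom)
qed

abbreviation "Fr \<equiv> map_poly (\<lambda>x::'b. x ^ q)"

lemma Fr_mult: "Fr (a * b) = Fr a * Fr b"
  by (rule map_poly_hom_mult) (use frob_add p_pow_pos in \<open>simp_all add: power_mult_distrib\<close>)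

lemma Fr_linear: "Fr [:- z, 1:] = [:- (z ^ q), 1:]"
  using p_pow_pos by (simp add: map_poly_pCons frob_minus)

lemma Fr_prod: "Fr (\<Prod>x\<in>A. f x) = (\<Prod>x\<in>A. Fr (f x))"
  by (rule map_poly_hom_prod) (use frob_add p_pow_pos in \<open>simp_all add: power_mult_distrib\<close>)

lemma Fr_power: "Fr (a ^ k) = Fr a ^ k"
  by (rule map_poly_hom_power) (use frob_add p_pow_pos in \<open>simp_all add: power_mult_distrib\<close>)

lemma Fr_E: "Fr (E a) = E a"
  using p_pow_pos by (intro poly_eqI) (simp add: coeff_map_poly emb_hom emb_frob)

lemma frob_inj: "x ^ q = y ^ q \<Longrightarrow> x = (y :: 'b)"
proof -
  assume "x ^ q = y ^ q"
  hence "(x + - y) ^ q = 0" unfolding frob_add frob_minus by simp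
  thus "x = y" by simp
qed

text \<open>Frobenius permutes the linear factors, hence fixes every coefficient of their product,
  and the fixed elements are those of the small field.\<close>

lemma root_poly_descends:
  assumes "finite S" "\<And>z. z \<in> S \<Longrightarrow> z ^ q \<in> S"
  obtains Q where "E Q = root_poly S"
proof -
  have inj: "inj_on (\<lambda>z. z ^ q) S" by (rule inj_onI) (rule frob_inj)
  \<comment> \<open>An injective self-map of a finite set is surjective, so stability under
    Frobenius already gives a permutation.\<close>
  have im: "(\<lambda>z. z ^ q) ` S = S"
    using assms by (intro endo_inj_surj inj) auto
  have "Fr (root_poly S) = (\<Prod>z\<in>S. [:- (z ^ q), 1:])"
    by (simp add: root_poly_def Fr_prod Fr_linear)
  also have "\<dots> = root_poly S"
    unfolding root_poly_def by (subst (2) im[symmetric]) (simp add: prod.reindex[OF inj])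
  finally have "coeff (root_poly S) i ^ q = coeff (root_poly S) i" for i
    using p_pow_pos by (metis (no_types, lifting) coeff_map_poly power_0_left less_irrefl)
  hence "\<forall>i. \<exists>x. coeff (root_poly S) i = emb x" using frob_fixed_in_range by blast
  then obtain x where x: "\<And>i. coeff (root_poly S) i = emb (x i)" by metis
  have "E (Poly (map x [0..<Suc (degree (root_poly S))])) = root_poly S"
  proof (rule poly_eqI)
    fix i
    show "coeff (E (Poly (map x [0..<Suc (degree (root_poly S))]))) i = coeff (root_poly S) i"
      using x[of i] coeff_eq_0[of "root_poly S" i]
      by (auto simp: coeff_map_poly emb_hom coeff_Poly_eq nth_default_def simp del: upt_Suc)
  qed
  thus ?thesis by (rule that)
qed

text \<open>Frobenius applied to the coefficients fixes \<open>E d\<close> and raises the root to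
  its \<open>q\<close>-th power: conjugate roots have at least the same multiplicity.\<close>

lemma frob_linear_power_dvd:
  assumes "[:- z, 1:] ^ k dvd E d"
  shows "[:- (z ^ (q ^ i)), 1:] ^ k dvd E d"
proof (induction i)
  case (Suc i)
  then obtain w where "E d = [:- (z ^ (q ^ i)), 1:] ^ k * w" by (elim dvdE)
  hence "E d = [:- ((z ^ (q ^ i)) ^ q), 1:] ^ k * Fr w"
    by (metis Fr_E Fr_mult Fr_power Fr_linear)
  thus ?case by (simp add: power_mult[symmetric] mult.commute)
qed (use assms in simp)

end

section \<open>LCD codes and stable sets of roots\<close>

text \<open>\<open>L\<close> is the part of the length for which X^L - 1 splits into distinct linear
  factors over \<open>'b\<close>; it becomes \<open>2 * l ^ m\<close> below.\<close>

locale cyclic_length = finite_field_embedding emb p s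
  for emb :: "'a::{field,finite} \<Rightarrow> 'b::field" and p s :: nat +
  fixes L n :: nat
  assumes L_pos: "L > 0" and card_roots: "card {z::'b. z ^ L = 1} = L"
begin

abbreviation "N \<equiv> L * p ^ n"
abbreviation "P \<equiv> p ^ n"
abbreviation "U \<equiv> {z::'b. z ^ L = 1}"

lemma N_pos: "N > 0" using L_pos p_pow_pos by simp

lemma finite_U: "finite U"
  using card_roots L_pos by (metis card.infinite less_irrefl)

lemma finite_subset_U: "S \<subseteq> U \<Longrightarrow> finite S"
  using finite_U finite_subset by blast

lemma U_nonzero: "z \<in> U \<Longrightarrow> z \<noteq> 0"
  using L_pos by (auto simp: power_0_left)

lemma U_inverse: "z \<in> U \<Longrightarrow> inverse z \<in> U"
  by (simp add: power_inverse)

lemma U_power: "z \<in> U \<Longrightarrow> z ^ k \<in> U"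
  by simp (metis mult.commute power_mult power_one)

text \<open>X^L - 1 is the product over its \<open>L\<close> distinct roots, and in characteristic
  \<open>p\<close> its \<open>P\<close>-th power is X^(LP) - 1.\<close>

lemma xn1_eq_root_poly: "(xn1 N :: 'b poly) = root_poly U ^ P"
proof -
  have "(xn1 L :: 'b poly) = root_poly U"
  \<comment> \<open>Both sides are monic of degree \<open>L\<close>, so their difference has smaller
    degree and agreement at the \<open>L\<close> points of \<open>U\<close> suffices.\<close>
  proof (rule poly_eqI_degree_lead_coeff[where n = L and A = U])
    show "coeff (xn1 L :: 'b poly) L = coeff (root_poly U) L"
      using lead_coeff_root_poly[of U] L_pos
      by (simp add: degree_root_poly card_roots xn1_def)
    show "poly (xn1 L) z = poly (root_poly U) z" if "z \<in> U" for z
      using that poly_root_poly[OF finite_U, of z] by (simp add: xn1_def poly_monom)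
  qed (simp_all add: card_roots degree_root_poly degree_xn1[OF L_pos])
  moreover have "(xn1 L :: 'b poly) ^ P = xn1 N"
  proof -
    have C: "CHAR('b poly) = p" using CHAR_b by simp
    have "(monom 1 L - 1 :: 'b poly) ^ P + 1 ^ P = (monom 1 L - 1 + 1) ^ P"
      by (rule freshmans_dream'[symmetric]) (simp_all only: C p_prime)
    thus ?thesis by (simp add: xn1_def monom_power algebra_simps)
  qed
  ultimately show ?thesis by simp
qed

text \<open>Each element of \<open>U\<close> is a root of \<open>xn1 N\<close> of multiplicity
  exactly \<open>P\<close>, and multiplicities add over the factorization.\<close>

lemma order_U:
  assumes "z \<in> U" "d * h = xn1 N"
  shows "order z (E d) + order z (E h) = P"
proof -
  have "root_poly U = root_poly (U - {z}) * [:- z, 1:]"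
    using assms(1) finite_U by (simp add: root_poly_def prod.remove mult.commute)
  hence "root_poly U ^ P = root_poly (U - {z}) ^ P * [:- z, 1:] ^ P"
    by (simp only: power_mult_distrib)
  moreover have "order z (root_poly (U - {z}) ^ P) = 0"
    by (rule order_0I) (use finite_U in \<open>simp add: poly_root_poly\<close>)
  ultimately have "order z (root_poly U ^ P) = P"
    by (simp add: order_mult order_power_n_n)
  moreover have eq: "E d * E h = root_poly U ^ P"
    by (simp add: E_mult[symmetric] assms(2) E_xn1 xn1_eq_root_poly)
  ultimately show ?thesis by (metis order_mult power_not_zero root_poly_neq_0)
qed

lemma linear_dvd_iff_order: "d \<noteq> 0 \<Longrightarrow> [:- z, 1:] dvd E d \<longleftrightarrow> order z (E d) > 0"
  using order_divides[of z 1 "E d"] by auto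

text \<open>Otherwise the quotient of \<open>xn1 N\<close> by the minimal polynomial of \<open>z\<close> lies in the code and in
  its dual.\<close>
lemma LCD_no_reciprocal_root:
  assumes dh: "d * h = xn1 N" and lcd: "LCD N (mult_code N d)"
    and z: "z \<in> U" and zh: "[:- z, 1:] dvd E h" and zd: "[:- inverse z, 1:] dvd E d"
  shows False
proof -
  \<comment> \<open>The Frobenius orbit of \<open>z\<close>; the polynomial \<open>Q\<close> that
    descends from it is the minimal polynomial of \<open>z\<close> over the small field.\<close>
  define S where "S = {z ^ (q ^ i) | i. True}"
  have SU: "S \<subseteq> U" using U_power[OF z] by (auto simp: S_def)
  have fS: "finite S" using SU by (rule finite_subset_U)
  obtain Q where Q: "E Q = root_poly S"
  proof (rule root_poly_descends[OF fS])
    fix w assume "w \<in> S"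
    then obtain i where "w = z ^ (q ^ i)" by (auto simp: S_def)
    hence "w ^ q = z ^ (q ^ Suc i)" by (simp add: power_mult[symmetric] mult.commute)
    thus "w ^ q \<in> S" unfolding S_def by blast
  qed
  have "z ^ (q ^ 0) \<in> S" unfolding S_def by blast
  hence "card S > 0" using fS by (auto simp: card_gt_0_iff)
  hence degQ: "degree Q > 0" using degree_root_poly[of S] Q by (metis degree_E)
  have nz: "d \<noteq> 0" "h \<noteq> 0" using dh xn1_neq_0[OF N_pos, where 'a='a] by auto
  have "root_poly S ^ 1 dvd E h"
    using frob_linear_power_dvd[of z 1 h] zh by (intro root_poly_power_dvd fS) (auto simp: S_def)
  hence "Q dvd h" using E_dvd_iff[of Q h] Q by simp
  then obtain k where k: "h = Q * k" by (elim dvdE)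
  \<comment> \<open>This is \<open>xn1 N\<close> divided by \<open>Q\<close>: a nonzero codeword
    that remains to be placed in the dual.\<close>
  define b where "b = d * k"
  have bQ: "b * Q = xn1 N" using dh k by (simp add: b_def ac_simps)
  have b0: "b \<noteq> 0" "Q \<noteq> 0" using nz k by (auto simp: b_def)
  have "degree (b * Q) = N" using bQ degree_xn1[OF N_pos, where 'a='a] by simp
  hence degb: "degree b < N" using b0 degQ by (simp add: degree_mult_eq)
  have "[:- inverse w, 1:] dvd E d" if "w \<in> S" for w
    using that frob_linear_power_dvd[of "inverse z" 1 d] zd by (auto simp: S_def power_inverse)
  hence "root_poly (inverse ` S) ^ 1 dvd E d"
    by (intro root_poly_power_dvd) (use fS in auto)
  \<comment> \<open>Up to a nonzero scalar, reflection replaces the roots by their inverses, all of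
    which are roots of \<open>d\<close>. Hence the reciprocal of \<open>Q\<close> divides
    \<open>d\<close>.\<close>
  moreover have "reflect_poly (root_poly S) = smult (\<Prod>w\<in>S. - w) (root_poly (inverse ` S))"
  proof -
    have "reflect_poly (root_poly S) = (\<Prod>w\<in>S. smult (- w) [:- inverse w, 1:])"
      unfolding root_poly_def reflect_poly_prod
      using SU U_nonzero by (intro prod.cong refl reflect_linear) auto
    also have "\<dots> = smult (\<Prod>w\<in>S. - w) (\<Prod>w\<in>S. [:- inverse w, 1:])"
      by (rule prod_smult)
    also have "(\<Prod>w\<in>S. [:- inverse w, 1:]) = root_poly (inverse ` S)"
      unfolding root_poly_def by (subst prod.reindex) (auto intro: inj_onI)
    finally show ?thesis .
  qed
  moreover have "(\<Prod>w\<in>S. - w) \<noteq> 0" using fS SU U_nonzero by auto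
  ultimately have "E (reflect_poly Q) dvd E d"
    by (simp add: E_reflect Q smult_dvd_iff)
  then obtain k' where k': "d = reflect_poly Q * k'" by (auto simp: E_dvd_iff elim: dvdE)
  \<comment> \<open>\<open>xn1 N\<close> is its own reciprocal up to sign, so reflecting
    \<open>b * Q\<close> gives \<open>d * h\<close> again; cancelling the reciprocal of
    \<open>Q\<close> leaves a multiple of \<open>h\<close>.\<close>
  have "reflect_poly b * reflect_poly Q = - (d * h)"
    by (metis reflect_poly_mult bQ reflect_xn1[OF N_pos] dh)
  hence "reflect_poly Q * reflect_poly b = reflect_poly Q * (- (k' * h))"
    by (simp add: k' ac_simps)
  hence "reflect_poly b = - (k' * h)" using b0 by (simp only: mult_cancel_left) auto
  hence "h dvd reverse_poly N b" by (simp add: reverse_poly_def)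
  moreover have "d dvd b" by (simp add: b_def)
  ultimately show False using lcd LCD_mult_code_iff[OF N_pos dh] degb b0 by blast
qed

text \<open>The two divisibilities say that \<open>d\<close> is the \<open>P\<close>-th power of a
  product over a stable root set, up to a unit; \<open>d\<close> need not be monic.\<close>

lemma LCD_imp_root_set:
  assumes d: "d dvd xn1 N" and lcd: "LCD N (mult_code N d)"
  obtains S where "S \<subseteq> U" "\<And>z. z \<in> S \<Longrightarrow> inverse z \<in> S" "\<And>z i. z \<in> S \<Longrightarrow> z ^ (q ^ i) \<in> S"
    "E d dvd root_poly S ^ P" "root_poly S ^ P dvd E d"
proof -
  obtain h where dh: "d * h = xn1 N" using d by (metis dvdE)
  have nz: "d \<noteq> 0" "h \<noteq> 0" using dh xn1_neq_0[OF N_pos, where 'a='a] by auto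
  define S where "S = {z\<in>U. [:- z, 1:] dvd E d}"
  have full: "order (inverse z) (E d) = P" if "z \<in> S" for z
  proof -
    have z: "z \<in> U" "inverse z \<in> U" using that U_inverse[of z] unfolding S_def by blast+
    \<comment> \<open>The exclusion of reciprocal roots is applied at \<open>inverse z\<close>,
      whose inverse \<open>z\<close> is a root of \<open>d\<close>. This puts
      \<open>inverse z\<close> into \<open>S\<close>; a second application returns to
      \<open>z\<close> itself.\<close>
    have "\<not> [:- inverse z, 1:] dvd E h"
      using LCD_no_reciprocal_root[OF dh lcd z(2)] that by (auto simp: S_def)
    hence "order (inverse z) (E h) = 0" using linear_dvd_iff_order[OF nz(2)] by simp
    thus ?thesis using order_U[OF z(2) dh] by simp
  qed
  have inv: "inverse z \<in> S" if "z \<in> S" for z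
  proof -
    have "inverse z \<in> U" using that U_inverse[of z] unfolding S_def by blast
    moreover have "[:- inverse z, 1:] dvd E d"
      using linear_dvd_iff_order[OF nz(1)] full[OF that] p_pow_pos by simp
    ultimately show ?thesis unfolding S_def by blast
  qed
  have SU: "S \<subseteq> U" by (auto simp: S_def)
  have "[:- z, 1:] ^ P dvd E d" if "z \<in> S" for z
    using full[OF inv[OF that]] nz by (simp add: order_divides)
  hence 1: "root_poly S ^ P dvd E d"
    using finite_subset_U[OF SU] by (intro root_poly_power_dvd)
  \<comment> \<open>Outside \<open>S\<close> the whole multiplicity \<open>P\<close> lies in
    \<open>h\<close>. This bounds \<open>d\<close> from above after the product over
    \<open>U - S\<close> is cancelled.\<close>
  have "[:- z, 1:] ^ P dvd E h" if "z \<in> U - S" for z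
  proof -
    have "order z (E d) = 0" using that linear_dvd_iff_order[OF nz(1)] by (auto simp: S_def)
    thus ?thesis using order_U[of z, OF _ dh] that by (auto simp: order_divides)
  qed
  hence 2: "root_poly (U - S) ^ P dvd E h"
    using finite_U by (intro root_poly_power_dvd) auto
  have "root_poly U = root_poly S * root_poly (U - S)"
    using root_poly_Un[of S "U - S"] finite_U finite_subset_U[OF SU] SU by (simp add: Un_absorb1)
  hence "E d * E h = root_poly S ^ P * root_poly (U - S) ^ P"
    by (metis E_mult dh E_xn1 xn1_eq_root_poly power_mult_distrib)
  moreover obtain w where "E h = root_poly (U - S) ^ P * w" using 2 by (elim dvdE)
  ultimately have "root_poly (U - S) ^ P * (E d * w) = root_poly (U - S) ^ P * root_poly S ^ P"
    by (simp add: ac_simps)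
  hence "E d * w = root_poly S ^ P" by simp
  hence 3: "E d dvd root_poly S ^ P" by (metis dvd_triv_left)
  have "z ^ (q ^ i) \<in> S" if "z \<in> S" for z i
    using that frob_linear_power_dvd[of z 1 d i] U_power[of z "q ^ i"] unfolding S_def by auto
  with SU inv 1 3 that show ?thesis by blast
qed

lemma root_set_dvd_xn1:
  assumes "S \<subseteq> U" "E d = root_poly S ^ P"
  shows "d dvd xn1 N"
proof -
  have "root_poly U = root_poly S * root_poly (U - S)"
    using root_poly_Un[of S "U - S"] finite_U finite_subset_U[OF assms(1)] assms(1)
    by (simp add: Un_absorb1)
  hence "E d dvd E (xn1 N)"
    by (simp add: E_xn1 xn1_eq_root_poly assms(2) power_mult_distrib)
  thus ?thesis by (simp add: E_dvd_iff)
qed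

text \<open>A word in the code and its dual has every \<open>z\<close> of \<open>U\<close> as a
  \<open>P\<close>-fold root: through \<open>d\<close> if \<open>z\<close> is in \<open>S\<close>,
  and otherwise through the reciprocal of \<open>h\<close>, as \<open>inverse z\<close> is then
  outside \<open>S\<close> too. It is therefore a multiple of \<open>xn1 N\<close> of degree below
  \<open>N\<close>.\<close>

lemma LCD_root_set:
  assumes SU: "S \<subseteq> U" and inv: "\<And>z. z \<in> S \<Longrightarrow> inverse z \<in> S" and d: "E d = root_poly S ^ P"
  shows "LCD N (mult_code N d)"
proof -
  obtain h where dh: "d * h = xn1 N" using root_set_dvd_xn1[OF SU d] by (metis dvdE)
  have "root_poly U = root_poly S * root_poly (U - S)"
    using root_poly_Un[of S "U - S"] finite_U finite_subset_U[OF SU] SU by (simp add: Un_absorb1)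
  hence "E d * E h = E d * root_poly (U - S) ^ P"
    by (metis E_mult d dh E_xn1 xn1_eq_root_poly power_mult_distrib)
  hence h: "E h = root_poly (U - S) ^ P" using d by simp
  show ?thesis unfolding LCD_mult_code_iff[OF N_pos dh]
  proof (intro allI impI)
    fix b assume b: "degree b < N" "d dvd b" "h dvd reverse_poly N b"
    have "[:- z, 1:] ^ P dvd E b" if "z \<in> U" for z
    proof (cases "z \<in> S")
      case True
      hence "[:- z, 1:] ^ P dvd E d"
        unfolding d using finite_subset_U[OF SU] by (intro dvd_power_same linear_dvd_root_poly)
      thus ?thesis using b(2) E_dvd_iff dvd_trans by blast
    next
      case False
      have z0: "z \<noteq> 0" using that by (rule U_nonzero)
      have "inverse z \<notin> S" using inv[of "inverse z"] False by auto
      hence "inverse z \<in> U - S" using U_inverse[OF that] by blast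
      hence "[:- inverse z, 1:] ^ P dvd E h"
        unfolding h using finite_U by (intro dvd_power_same linear_dvd_root_poly) auto
      then obtain w where "E h = [:- inverse z, 1:] ^ P * w" by (elim dvdE)
      hence "E (reflect_poly h) = smult (- inverse z) [:- z, 1:] ^ P * reflect_poly w"
        using reflect_linear[of "inverse z"] z0
        by (simp add: E_reflect reflect_poly_mult reflect_poly_power)
      hence "smult ((- inverse z) ^ P) ([:- z, 1:] ^ P) dvd E (reflect_poly h)"
        by (metis dvd_triv_left smult_power)
      hence "[:- z, 1:] ^ P dvd E (reflect_poly h)" using z0 by (simp add: smult_dvd_iff)
      moreover have "E (reflect_poly h) dvd E b"
        using dvd_reverse_polyD[OF b(1,3)] by (simp add: E_dvd_iff)
      ultimately show ?thesis by (rule dvd_trans)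
    qed
    hence "E (xn1 N) dvd E b"
      unfolding E_xn1 xn1_eq_root_poly by (intro root_poly_power_dvd finite_U)
    hence "xn1 N dvd b" by (simp add: E_dvd_iff)
    thus "b = 0"
      using b(1) dvd_imp_degree_le[of "xn1 N" b] degree_xn1[OF N_pos, where 'a='a] by force
  qed
qed

text \<open>Blocks \<open>B t\<close> are the orbits of the roots of unity under Frobenius and inversion.\<close>
theorem LCD_codes_of_blocks:
  fixes T :: "'t set" and B :: "'t \<Rightarrow> 'b set" and Q :: "'t \<Rightarrow> 'a poly"
  assumes T: "finite T" and cover: "(\<Union>t\<in>T. B t) = U" and disj: "\<And>t u. t \<in> T \<Longrightarrow> u \<in> T \<Longrightarrow> t \<noteq> u \<Longrightarrow> B t \<inter> B u = {}"
    and ne: "\<And>t. t \<in> T \<Longrightarrow> B t \<noteq> {}"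
    and Q: "\<And>t. t \<in> T \<Longrightarrow> E (Q t) = root_poly (B t)"
    and inv: "\<And>t z. t \<in> T \<Longrightarrow> z \<in> B t \<Longrightarrow> inverse z \<in> B t"
    and orbit: "\<And>t z w. t \<in> T \<Longrightarrow> z \<in> B t \<Longrightarrow> w \<in> B t \<Longrightarrow>
      \<exists>i. w = z ^ (q ^ i) \<or> w = inverse z ^ (q ^ i)"
  shows "{C. cyclic_code N C \<and> LCD N C} =
      {code_gen N (\<Prod>t\<in>T. Q t ^ \<epsilon> t) | \<epsilon>. \<forall>t\<in>T. \<epsilon> t \<in> {0, P}}" (is "?LCD = ?gens")
    and "card {C :: 'a poly set. cyclic_code N C \<and> LCD N C} = 2 ^ card T"
proof -
  \<comment> \<open>A choice of exponents in \<open>{0, P}\<close> is encoded by the subset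
    \<open>A\<close> of blocks that receive \<open>P\<close>, so counting codes becomes counting
    \<open>Pow T\<close>.\<close>
  define G where "G A = (\<Prod>t\<in>A. Q t ^ P)" for A
  define W where "W A = (\<Union>t\<in>A. B t)" for A
  have BU: "B t \<subseteq> U" if "t \<in> T" for t using cover that by blast
  have WU: "W A \<subseteq> U" if "A \<subseteq> T" for A using BU that by (auto simp: W_def)
  have EG: "E (G A) = root_poly (W A) ^ P" if A: "A \<subseteq> T" for A
  proof -
    have "E (G A) = (\<Prod>t\<in>A. root_poly (B t)) ^ P"
      using A Q by (auto simp: G_def E_prod E_power prod_power_distrib intro!: prod.cong)
    also have "(\<Prod>t\<in>A. root_poly (B t)) = root_poly (W A)"
      unfolding root_poly_def W_def
    proof (rule prod.UNION_disjoint[symmetric])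
      show "finite A" using A T by (rule finite_subset)
      show "\<forall>t\<in>A. finite (B t)" using A BU finite_subset_U by blast
      show "\<forall>t\<in>A. \<forall>u\<in>A. t \<noteq> u \<longrightarrow> B t \<inter> B u = {}" using A disj by blast
    qed
    finally show ?thesis .
  qed
  have Gx: "G A dvd xn1 N" if "A \<subseteq> T" for A
    using root_set_dvd_xn1[OF WU EG] that by blast
  have G_code: "code_gen N (G A) = mult_code N (G A)" if "A \<subseteq> T" for A
    using code_gen_eq_mult_code[OF N_pos Gx] that by blast
  have W_sub: "A \<subseteq> A'" if W: "A \<subseteq> T" "A' \<subseteq> T" "W A \<subseteq> W A'" for A A'
  proof
    fix t assume t: "t \<in> A"
    then obtain z where z: "z \<in> B t" using ne W by blast
    hence "z \<in> W A'" using t W by (auto simp: W_def)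
    then obtain t' where "t' \<in> A'" "z \<in> B t'" by (auto simp: W_def)
    thus "t \<in> A'" using disj z t W by blast
  qed
  \<comment> \<open>Divisibility of generators gives inclusion of root sets, and nonempty disjoint
    blocks recover the index sets. Used in both directions, this yields injectivity.\<close>
  have sub: "A' \<subseteq> A" if "A \<subseteq> T" "A' \<subseteq> T" "code_gen N (G A) = code_gen N (G A')" for A A'
  proof -
    have "G A' dvd G A"
      using mult_code_subset_imp_dvd[OF N_pos Gx Gx] that G_code by auto
    hence "root_poly (W A') ^ P dvd root_poly (W A) ^ P" using EG that E_dvd_iff by metis
    moreover have "z \<in> W A" if "root_poly (W A') ^ P dvd root_poly (W A) ^ P" "z \<in> W A'" for z
    proof -
      have "poly (root_poly (W A') ^ P) z = 0"
        using that poly_root_poly[OF finite_subset_U[OF WU], of A' z] \<open>A' \<subseteq> T\<close> p_pow_pos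
        by (simp add: power_0_left)
      hence "poly (root_poly (W A) ^ P) z = 0"
        using that(1) by (metis dvdE mult_eq_0_iff poly_mult)
      thus ?thesis using poly_root_poly[OF finite_subset_U[OF WU], of A z] \<open>A \<subseteq> T\<close> by simp
    qed
    ultimately show ?thesis using W_sub that by blast
  qed
  have inj: "inj_on (\<lambda>A. code_gen N (G A)) (Pow T)"
    by (rule inj_onI) (use sub in blast)
  have "C \<in> ?LCD \<longleftrightarrow> C \<in> (\<lambda>A. code_gen N (G A)) ` Pow T" for C
  proof
    assume "C \<in> ?LCD"
    hence C: "cyclic_code N C" "LCD N C" by auto
    obtain d where d: "d dvd xn1 N" "C = mult_code N d"
      using cyclic_code_principal[OF N_pos C(1)] .
    obtain S where S: "S \<subseteq> U" "\<And>z. z \<in> S \<Longrightarrow> inverse z \<in> S" "\<And>z i. z \<in> S \<Longrightarrow> z ^ (q ^ i) \<in> S"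
      "E d dvd root_poly S ^ P" "root_poly S ^ P dvd E d"
      using LCD_imp_root_set[OF d(1)] C d(2) by metis
    \<comment> \<open>Each block is one orbit under Frobenius and inversion, so the stable set
      \<open>S\<close> contains every block that it meets.\<close>
    define A where "A = {t\<in>T. B t \<inter> S \<noteq> {}}"
    have A: "A \<subseteq> T" by (auto simp: A_def)
    have "S \<subseteq> W A"
    proof
      fix z assume z: "z \<in> S"
      then obtain t where "t \<in> T" "z \<in> B t" using S(1) cover by blast
      thus "z \<in> W A" using z by (auto simp: A_def W_def)
    qed
    moreover have "W A \<subseteq> S"
    proof
      fix w assume "w \<in> W A"
      then obtain t z where t: "t \<in> T" "w \<in> B t" "z \<in> B t" "z \<in> S" by (auto simp: A_def W_def)
      then obtain i where "w = z ^ (q ^ i) \<or> w = inverse z ^ (q ^ i)" using orbit by blast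
      thus "w \<in> S" using t S(2,3) by blast
    qed
    ultimately have "S = W A" by blast
    hence "d dvd G A" "G A dvd d" using S(4,5) EG[OF A] E_dvd_iff by metis+
    hence "mult_code N d = mult_code N (G A)"
      unfolding mult_code_def using dvd_trans by blast
    thus "C \<in> (\<lambda>A. code_gen N (G A)) ` Pow T" using d(2) G_code[OF A] A by auto
  next
    assume "C \<in> (\<lambda>A. code_gen N (G A)) ` Pow T"
    then obtain A where A: "A \<subseteq> T" "C = mult_code N (G A)" using G_code by auto
    have "inverse z \<in> W A" if "z \<in> W A" for z using that inv A by (auto simp: W_def)
    hence "LCD N C" unfolding A(2) by (intro LCD_root_set[OF WU[OF A(1)] _ EG[OF A(1)]])
    thus "C \<in> ?LCD" using cyclic_code_mult_code[OF N_pos Gx[OF A(1)]] A(2) by simp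
  qed
  hence eq: "?LCD = (\<lambda>A. code_gen N (G A)) ` Pow T" by blast
  have "card ?LCD = card (Pow T)" unfolding eq by (rule card_image[OF inj])
  thus "card ?LCD = 2 ^ card T" using T by (simp add: card_Pow)
  have G_exp: "(\<Prod>t\<in>T. Q t ^ \<epsilon> t) = G {t\<in>T. \<epsilon> t \<noteq> 0}" if "\<forall>t\<in>T. \<epsilon> t \<in> {0, P}" for \<epsilon>
    unfolding G_def using that T by (intro prod.mono_neutral_cong_right) auto
  show "?LCD = ?gens"
  proof (unfold eq, intro equalityI subsetI)
    fix C assume "C \<in> (\<lambda>A. code_gen N (G A)) ` Pow T"
    then obtain A where A: "A \<subseteq> T" "C = code_gen N (G A)" by auto
    define \<epsilon> where "\<epsilon> t = (if t \<in> A then P else 0)" for t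
    have "{t\<in>T. \<epsilon> t \<noteq> 0} = A" using A p_pow_pos by (auto simp: \<epsilon>_def)
    hence "C = code_gen N (\<Prod>t\<in>T. Q t ^ \<epsilon> t)" using G_exp[of \<epsilon>] A(2) by (simp add: \<epsilon>_def)
    moreover have "\<forall>t\<in>T. \<epsilon> t \<in> {0, P}" by (simp add: \<epsilon>_def)
    ultimately show "C \<in> ?gens" by blast
  next
    fix C assume "C \<in> ?gens"
    thus "C \<in> (\<lambda>A. code_gen N (G A)) ` Pow T" using G_exp by fastforce
  qed
qed

end

section \<open>Cyclotomic cosets modulo a prime power\<close>

text \<open>Half the order gives a \<open>y\<close> with y^2 = 1. The odd prime \<open>l\<close>
  cannot divide both y - 1 and y + 1, so \<open>l ^ r\<close> divides one of them, and y = 1 would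
  contradict the order. Both the field size and the generator \<open>g\<close> are later put in the
  place of \<open>q\<close>.\<close>

lemma cong_minus_one_half_ord:
  fixes l r q :: nat
  assumes l: "prime l" "odd l" and cop: "coprime q l" and ev: "even (ord (l ^ r) q)"
  shows "[int q ^ (ord (l ^ r) q div 2) = - 1] (mod int (l ^ r))"
proof -
  define i where "i = ord (l ^ r) q div 2"
  define y where "y = int q ^ i"
  have o: "ord (l ^ r) q = 2 * i" using ev by (simp add: i_def)
  have pos: "ord (l ^ r) q > 0" using cop by (simp add: coprime_commute)
  have "[q ^ (2 * i) = 1] (mod l ^ r)" using ord[of q "l ^ r"] by (simp add: o)
  hence "[int (q ^ (2 * i)) = int 1] (mod int (l ^ r))" by (simp only: cong_int_iff)
  hence "int l ^ r dvd y ^ 2 - 1"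
    by (simp add: cong_iff_dvd_diff y_def power_mult[symmetric] mult.commute)
  also have "y ^ 2 - 1 = (y - 1) * (y + 1)" by (simp add: power2_eq_square algebra_simps)
  finally have dvd: "int l ^ r dvd (y - 1) * (y + 1)" .
  have pl: "prime (int l)" using l by simp
  have "\<not> int l dvd y + 1 \<or> \<not> int l dvd y - 1"
  proof (rule ccontr)
    assume "\<not> ?thesis"
    hence "int l dvd (y + 1) - (y - 1)" by (metis dvd_diff)
    hence "int l dvd int 2" by simp
    hence "l dvd 2" by (simp only: int_dvd_int_iff)
    thus False using l by (metis primes_dvd_imp_eq two_is_prime_nat even_numeral dvd_refl)
  qed
  thus ?thesis
  proof
    assume "\<not> int l dvd y + 1"
    hence "coprime (int l ^ r) (y + 1)" using pl by (simp add: prime_imp_coprime)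
    hence "int l ^ r dvd y - 1" using dvd by (simp add: coprime_dvd_mult_left_iff)
    hence "[int (q ^ i) = int 1] (mod int (l ^ r))" by (simp add: cong_iff_dvd_diff y_def)
    hence "[q ^ i = 1] (mod l ^ r)" by (simp only: cong_int_iff)
    hence "2 * i dvd i" by (simp add: ord_divides' o)
    thus ?thesis using pos o by (auto dest: dvd_imp_le)
  next
    assume "\<not> int l dvd y - 1"
    hence "coprime (int l ^ r) (y - 1)" using pl by (simp add: prime_imp_coprime)
    hence "int l ^ r dvd y + 1" using dvd by (simp add: coprime_dvd_mult_right_iff)
    thus ?thesis by (simp add: cong_iff_dvd_diff y_def i_def)
  qed
qed

lemma ord_dvd_ord_power:
  fixes l r q :: nat
  assumes "r > 0"
  shows "ord l q dvd ord (l ^ r) q"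
proof -
  have "[q ^ ord (l ^ r) q = 1] (mod l)"
    using ord[of q "l ^ r"] by (rule cong_dvd_modulus_nat) (use assms in \<open>simp add: dvd_power\<close>)
  thus ?thesis by (simp add: ord_divides')
qed

text \<open>If a power were -1, squaring and the odd order would force the same power to be 1, hence
  \<open>l\<close> to divide 2.\<close>

lemma odd_ord_imp_not_cong_minus_one:
  fixes l q :: nat
  assumes l: "prime l" "odd l" and od: "odd (ord l q)"
  shows "\<not> [int q ^ i = - 1] (mod int l)"
proof
  assume A: "[int q ^ i = - 1] (mod int l)"
  hence "[int q ^ i * int q ^ i = - 1 * - 1] (mod int l)" by (rule cong_mult[OF _ A])
  hence "[int (q ^ (2 * i)) = int 1] (mod int l)" by (simp add: mult_2 power_add)
  hence "[q ^ (2 * i) = 1] (mod l)" by (simp only: cong_int_iff)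
  hence "ord l q dvd 2 * i" by (simp add: ord_divides')
  hence "ord l q dvd i" using od by (metis coprime_dvd_mult_right_iff coprime_right_2_iff_odd)
  hence "[q ^ i = 1] (mod l)" by (simp add: ord_divides')
  hence "[int (q ^ i) = int 1] (mod int l)" by (simp only: cong_int_iff)
  hence "[1 = - 1] (mod int l)" using A by (simp add: cong_def)
  hence "int l dvd int 2" by (simp add: cong_iff_dvd_diff)
  hence "l dvd 2" by (simp only: int_dvd_int_iff)
  thus False using l by (metis primes_dvd_imp_eq two_is_prime_nat even_numeral dvd_refl)
qed

text \<open>An even order modulo \<open>l ^ r\<close> would make -1 a power of \<open>q\<close>
  modulo \<open>l ^ r\<close>, hence also modulo \<open>l\<close>.\<close>

lemma odd_ord_power:
  fixes l r q :: nat
  assumes "prime l" "odd l" "coprime q l" "odd (ord l q)" "r > 0"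
  shows "odd (ord (l ^ r) q)"
proof
  assume "even (ord (l ^ r) q)"
  from cong_minus_one_half_ord[OF assms(1-3) this]
  have "[int q ^ (ord (l ^ r) q div 2) = - 1] (mod int l)"
    by (rule cong_dvd_modulus) (use assms in \<open>simp add: dvd_power\<close>)
  thus False using odd_ord_imp_not_cong_minus_one assms by blast
qed

section \<open>The cyclic unit group modulo a prime power\<close>

locale prime_power_generator =
  fixes l m q g :: nat
  assumes l_prime: "prime l" and l_odd: "odd l" and m_pos: "m > 0"
    and q_cop: "coprime q l" and g_cop: "coprime g l" and g_ord: "ord (l ^ m) g = totient (l ^ m)"
begin

lemma l_gt_1: "l > 1" using l_prime by (rule prime_gt_1_nat)

text \<open>Equality of cyclotomic cosets, phrased as a congruence between integers so that negation
  and scaling are easy to handle.\<close>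

definition rel :: "int \<Rightarrow> int \<Rightarrow> bool" where
  "rel a b \<longleftrightarrow> (\<exists>i. [a = b * int q ^ i] (mod int (l ^ m)))"

lemma relI: "[a = b * int q ^ i] (mod int (l ^ m)) \<Longrightarrow> rel a b"
  by (auto simp: rel_def)

lemma rel_refl: "rel a a"
  by (rule relI[where i = 0]) simp

lemma rel_minus: "rel a b \<Longrightarrow> rel (- a) (- b)"
  unfolding rel_def by (metis cong_minus_minus_iff mult_minus_left)

lemma rel_trans:
  assumes "rel a b" "rel b c"
  shows "rel a c"
proof -
  obtain i j where i: "[a = b * int q ^ i] (mod int (l ^ m))" and j: "[b = c * int q ^ j] (mod int (l ^ m))"
    using assms by (auto simp: rel_def)
  have "[b * int q ^ i = c * int q ^ j * int q ^ i] (mod int (l ^ m))"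
    by (rule cong_mult[OF j]) simp
  with i have "[a = c * int q ^ j * int q ^ i] (mod int (l ^ m))" by (rule cong_trans)
  thus ?thesis by (intro relI[where i = "j + i"]) (simp add: power_add ac_simps)
qed

text \<open>The exponent \<open>i * (ord (l ^ r) q - 1)\<close> complements \<open>i\<close> to a
  multiple of the order.\<close>

lemma q_power_inverse:
  obtains j where "[q ^ i * q ^ j = 1] (mod l ^ r)"
proof -
  have "ord (l ^ r) q > 0" using q_cop by (simp add: coprime_commute)
  hence "i + i * (ord (l ^ r) q - 1) = ord (l ^ r) q * i" by (cases "ord (l ^ r) q") auto
  hence "q ^ i * q ^ (i * (ord (l ^ r) q - 1)) = (q ^ ord (l ^ r) q) ^ i"
    by (simp only: power_add[symmetric] power_mult[symmetric])
  moreover have "[(q ^ ord (l ^ r) q) ^ i = 1 ^ i] (mod l ^ r)" by (intro cong_pow ord)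
  ultimately show ?thesis using that by (metis power_one)
qed

lemma rel_sym:
  assumes "rel a b"
  shows "rel b a"
proof -
  obtain i where i: "[a = b * int q ^ i] (mod int (l ^ m))" using assms by (auto simp: rel_def)
  obtain j where "[q ^ i * q ^ j = 1] (mod l ^ m)" by (rule q_power_inverse)
  hence "[int (q ^ i * q ^ j) = int 1] (mod int (l ^ m))" by (simp only: cong_int_iff)
  hence "[b * (int q ^ i * int q ^ j) = b * 1] (mod int (l ^ m))" by (intro cong_mult) simp_all
  moreover have "[a * int q ^ j = b * int q ^ i * int q ^ j] (mod int (l ^ m))"
    by (rule cong_mult[OF i]) simp
  ultimately have "[a * int q ^ j = b] (mod int (l ^ m))" by (metis cong_trans mult.assoc mult_1_right)
  thus ?thesis by (intro relI) (rule cong_sym)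
qed

lemma cyclo_coset_eq_iff:
  "cyclo_coset q (l ^ m) a = cyclo_coset q (l ^ m) b \<longleftrightarrow> rel a b"
proof -
  have pos: "int (l ^ m) > 0" using l_gt_1 by simp
  have mem: "x \<in> cyclo_coset q (l ^ m) t \<longleftrightarrow> (\<exists>i. x = nat ((t * int q ^ i) mod int (l ^ m)))" for x t
    by (auto simp: cyclo_coset_def)
  have nat_eq: "nat (x mod int (l ^ m)) = nat (y mod int (l ^ m)) \<longleftrightarrow> [x = y] (mod int (l ^ m))" for x y
    unfolding cong_def using pos by (metis eq_nat_nat_iff pos_mod_sign)
  have sub: "cyclo_coset q (l ^ m) a \<subseteq> cyclo_coset q (l ^ m) b" if "rel a b" for a b
  proof
    fix x assume "x \<in> cyclo_coset q (l ^ m) a"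
    then obtain i where x: "x = nat ((a * int q ^ i) mod int (l ^ m))" using mem by blast
    have "rel (a * int q ^ i) b"
      using rel_trans[OF relI[of _ a i] that] by simp
    then obtain j where "[a * int q ^ i = b * int q ^ j] (mod int (l ^ m))" by (auto simp: rel_def)
    hence "x = nat ((b * int q ^ j) mod int (l ^ m))" by (simp only: x nat_eq)
    thus "x \<in> cyclo_coset q (l ^ m) b" using mem by blast
  qed
  show ?thesis
  proof
    assume eq: "cyclo_coset q (l ^ m) a = cyclo_coset q (l ^ m) b"
    have "nat ((a * int q ^ 0) mod int (l ^ m)) \<in> cyclo_coset q (l ^ m) b"
      unfolding eq[symmetric] using mem by blast
    then obtain i where "nat ((a * int q ^ 0) mod int (l ^ m)) = nat ((b * int q ^ i) mod int (l ^ m))"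
      using mem by blast
    hence "[a * int q ^ 0 = b * int q ^ i] (mod int (l ^ m))" by (simp only: nat_eq)
    thus "rel a b" by (intro relI) simp
  qed (use sub rel_sym in blast)
qed

text \<open>Divisibility by powers of \<open>l\<close> is an invariant of the coset; it later
  separates representatives of different levels \<open>r\<close>.\<close>

lemma rel_dvd:
  assumes "rel a b" "j \<le> m" "int l ^ j dvd a"
  shows "int l ^ j dvd b"
proof -
  obtain i where "[b = a * int q ^ i] (mod int (l ^ m))"
    using rel_sym[OF assms(1)] by (auto simp: rel_def)
  hence "[b = a * int q ^ i] (mod int l ^ j)"
    by (rule cong_dvd_modulus) (use assms(2) in \<open>simp add: le_imp_power_dvd\<close>)
  thus ?thesis using assms(3) by (simp add: cong_dvd_iff)
qed

lemma generator_powers: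
  assumes "r \<le> m" "coprime u (int l)"
  obtains j where "[u = int g ^ j] (mod int (l ^ r))"
proof -
  have lm: "l ^ m > 1" using l_gt_1 m_pos by (metis one_less_power)
  have "residue_primroot (l ^ m) g"
    using l_gt_1 g_cop g_ord by (simp add: residue_primroot_def coprime_commute)
  hence bij: "bij_betw (\<lambda>i. g ^ i mod l ^ m) {..<totient (l ^ m)} (totatives (l ^ m))"
    by (intro residue_primroot_is_generator lm)
  define v where "v = nat (u mod int (l ^ m))"
  have v: "int v = u mod int (l ^ m)" using l_gt_1 by (simp add: v_def)
  have "coprime (u mod int (l ^ m)) (int (l ^ m))"
    using assms(2) l_gt_1 by (subst coprime_mod_left_iff) auto
  hence cv: "coprime v (l ^ m)" unfolding v[symmetric] by (simp only: coprime_int_iff)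
  have "v < l ^ m" using v lm by (metis of_nat_less_iff pos_mod_bound of_nat_0_less_iff gr0I less_nat_zero_code)
  moreover have "v > 0" using cv lm by (cases v) auto
  ultimately have "v \<in> totatives (l ^ m)" using cv by (auto simp: totatives_def)
  then obtain j where "v = g ^ j mod l ^ m" using bij by (auto simp: bij_betw_def)
  hence "[v = g ^ j] (mod l ^ m)" by (simp add: cong_def)
  hence "[int v = int (g ^ j)] (mod int (l ^ m))" by (simp only: cong_int_iff)
  hence "[u = int g ^ j] (mod int (l ^ m))" unfolding v by (simp add: cong_def)
  hence "[u = int g ^ j] (mod int (l ^ r))"
    by (rule cong_dvd_modulus) (use assms(1) in \<open>simp add: le_imp_power_dvd\<close>)
  thus ?thesis by (rule that)
qed

text \<open>Powers of \<open>g\<close> exhaust the units modulo \<open>l ^ m\<close>, hence also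
  modulo \<open>l ^ r\<close>, so the order cannot be smaller than the number of units.\<close>

lemma ord_generator:
  assumes "r \<le> m"
  shows "ord (l ^ r) g = totient (l ^ r)"
proof (rule antisym)
  have c: "coprime (l ^ r) g" using g_cop by (simp add: coprime_commute)
  have "totient (l ^ r) > 0" using l_gt_1 by simp
  thus "ord (l ^ r) g \<le> totient (l ^ r)" by (rule dvd_imp_le[OF order_divides_totient[OF c]])
  \<comment> \<open>The extra element 1 covers \<open>r = 0\<close>: the totatives of 1 are {1},
    whereas residues modulo 1 are 0.\<close>
  have "totatives (l ^ r) \<subseteq> (\<lambda>i. g ^ i mod l ^ r) ` {..<ord (l ^ r) g} \<union> {1}"
  proof
    fix u assume u: "u \<in> totatives (l ^ r)"
    show "u \<in> (\<lambda>i. g ^ i mod l ^ r) ` {..<ord (l ^ r) g} \<union> {1}"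
    proof (cases "r = 0")
      case False
      have "coprime u l" using u False by (simp add: totatives_def)
      hence "coprime (int u) (int l)" by simp
      from generator_powers[OF assms this] obtain j where "[int u = int g ^ j] (mod int (l ^ r))" .
      hence "[int u = int (g ^ j)] (mod int (l ^ r))" by simp
      hence uj: "[u = g ^ j] (mod l ^ r)" by (simp only: cong_int_iff)
      let ?i = "j mod ord (l ^ r) g"
      have "[g ^ j = g ^ ?i] (mod l ^ r)"
        by (subst order_divides_expdiff[OF c]) (simp add: cong_def)
      with uj have "u mod l ^ r = g ^ ?i mod l ^ r" by (simp add: cong_def)
      moreover have "u < l ^ r"
      proof -
        have "u \<noteq> l ^ r" using u False l_gt_1 by (auto simp: totatives_def)
        thus ?thesis using u by (auto simp: totatives_def)
      qed
      moreover have "ord (l ^ r) g > 0" using c by simp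
      ultimately show ?thesis by (auto intro!: image_eqI[of _ _ ?i])
    qed (use u in \<open>auto simp: totatives_def\<close>)
  qed
  moreover have "1 \<in> (\<lambda>i. g ^ i mod l ^ r) ` {..<ord (l ^ r) g}" if "r > 0"
  proof -
    have "l ^ r > 1" using that l_gt_1 by (metis one_less_power)
    moreover have "ord (l ^ r) g > 0" using c by simp
    ultimately show ?thesis by (intro image_eqI[of _ _ 0]) (simp_all only: lessThan_iff power_0 mod_less)
  qed
  ultimately have "totatives (l ^ r) \<subseteq> (\<lambda>i. g ^ i mod l ^ r) ` {..<ord (l ^ r) g}" if "r > 0"
    using that by blast
  hence "card (totatives (l ^ r)) \<le> card ((\<lambda>i. g ^ i mod l ^ r) ` {..<ord (l ^ r) g})" if "r > 0"
    using that by (intro card_mono) auto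
  also have "\<dots> \<le> card {..<ord (l ^ r) g}" by (rule card_image_le) simp
  finally show "totient (l ^ r) \<le> ord (l ^ r) g" by (cases "r = 0") (auto simp: totient_def)
qed

definition \<delta> :: "nat \<Rightarrow> nat" where
  "\<delta> r = totient (l ^ r) div ord (l ^ r) q"

text \<open>In a cyclic group of order \<open>totient (l ^ r)\<close>, the power g^c has order
  \<open>totient (l ^ r)\<close> divided by the gcd with \<open>c\<close>. So
  \<open>\<delta> r\<close>, the index of the subgroup generated by \<open>q\<close>, is that
  gcd.\<close>

lemma q_as_generator_power:
  assumes "r \<le> m"
  obtains c where "[q = g ^ c] (mod l ^ r)" "ord (l ^ r) q * \<delta> r = totient (l ^ r)"
    "\<delta> r = gcd c (totient (l ^ r))"
proof -
  have "coprime (int q) (int l)" using q_cop by simp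
  from generator_powers[OF assms this] obtain c where "[int q = int g ^ c] (mod int (l ^ r))" .
  hence "[int q = int (g ^ c)] (mod int (l ^ r))" by simp
  hence c: "[q = g ^ c] (mod l ^ r)" by (simp only: cong_int_iff)
  hence "ord (l ^ r) q = ord (l ^ r) (g ^ c)" by (intro ord_cong)
  hence *: "ord (l ^ r) q * gcd c (totient (l ^ r)) = totient (l ^ r)"
    using ord_power_aux[of "l ^ r" g c] ord_generator[OF assms] by simp
  moreover have "ord (l ^ r) q > 0" using q_cop by (simp add: coprime_commute)
  ultimately have "\<delta> r = gcd c (totient (l ^ r))"
    unfolding \<delta>_def by (metis nonzero_mult_div_cancel_left less_irrefl)
  with c * that show ?thesis by metis
qed

text \<open>By Bezout, the gcd \<open>\<delta> r\<close> is a multiple of \<open>c\<close> modulo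
  the order of \<open>g\<close>.\<close>

lemma generator_power_\<delta>:
  assumes "r \<le> m"
  obtains i where "[g ^ \<delta> r = q ^ i] (mod l ^ r)"
proof -
  obtain c where c: "[q = g ^ c] (mod l ^ r)" "\<delta> r = gcd c (totient (l ^ r))"
    using q_as_generator_power[OF assms] .
  obtain x where "[c * x = \<delta> r] (mod totient (l ^ r))"
    using cong_solve_nat[of c "totient (l ^ r)"] c(2) by auto
  hence "[g ^ (c * x) = g ^ \<delta> r] (mod l ^ r)"
    using g_cop ord_generator[OF assms] by (subst order_divides_expdiff) (auto simp: coprime_commute)
  moreover have "[q ^ x = (g ^ c) ^ x] (mod l ^ r)" by (intro cong_pow c)
  ultimately have "[q ^ x = g ^ \<delta> r] (mod l ^ r)" by (simp add: power_mult cong_def)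
  thus ?thesis by (intro that) (rule cong_sym)
qed

end

section \<open>Representatives of the cosets when the order is odd\<close>

locale prime_power_generator_odd = prime_power_generator +
  assumes ord_odd: "odd (ord l q)"
begin

lemma \<delta>_facts:
  assumes "0 < r" "r \<le> m"
  shows "even (\<delta> r)" "ord (l ^ r) q * (\<delta> r div 2) = totient (l ^ r) div 2"
    "ord (l ^ r) q * \<delta> r = totient (l ^ r)" "\<delta> r > 0"
proof -
  have od: "odd (ord (l ^ r) q)"
    using odd_ord_power[OF l_prime l_odd q_cop ord_odd assms(1)] .
  show *: "ord (l ^ r) q * \<delta> r = totient (l ^ r)"
    using q_as_generator_power[OF assms(2)] by blast
  have "l \<noteq> 2" using l_odd by auto
  hence "l > 2" using l_gt_1 by simp
  moreover have "l ^ 1 \<le> l ^ r" using assms l_gt_1 by (intro power_increasing) auto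
  ultimately have "even (totient (l ^ r))" by (intro totient_even) simp
  thus ev: "even (\<delta> r)" using * od by (metis even_mult_iff)
  show "ord (l ^ r) q * (\<delta> r div 2) = totient (l ^ r) div 2"
    using ev unfolding *[symmetric] by (simp add: div_mult_swap)
  have "totient (l ^ r) > 0" using l_gt_1 by simp
  thus "\<delta> r > 0" using * by (metis gr0I mult_0_right less_irrefl)
qed

lemma generator_half:
  assumes "0 < r" "r \<le> m"
  shows "[int g ^ (ord (l ^ r) q * (\<delta> r div 2)) = - 1] (mod int (l ^ r))"
proof -
  have "even (ord (l ^ r) g)"
    using \<delta>_facts[OF assms] ord_generator[OF assms(2)] by (metis even_mult_iff)
  from cong_minus_one_half_ord[OF l_prime l_odd g_cop this] show ?thesis
    using \<delta>_facts[OF assms] ord_generator[OF assms(2)] by simp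
qed

text \<open>Write the odd order of \<open>q\<close> as 2y + 1. Then -1 is \<open>g\<close> to the
  power \<open>\<delta> r * y + \<delta> r div 2\<close>, and the part
  \<open>g ^ (\<delta> r * y)\<close> is a power of \<open>q\<close>, which can be inverted.\<close>

lemma generator_half_\<delta>:
  assumes r: "0 < r" "r \<le> m"
  obtains b where "[int g ^ (\<delta> r div 2) = - (int q ^ b)] (mod int (l ^ r))"
proof -
  have od: "odd (ord (l ^ r) q)"
    using odd_ord_power[OF l_prime l_odd q_cop ord_odd r(1)] .
  then obtain y where y: "ord (l ^ r) q = 2 * y + 1" by (auto elim: oddE)
  obtain a where a: "[g ^ \<delta> r = q ^ a] (mod l ^ r)" using generator_power_\<delta>[OF r(2)] .
  obtain b where b: "[q ^ (a * y) * q ^ b = 1] (mod l ^ r)" by (rule q_power_inverse)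
  let ?h = "\<delta> r div 2"
  have "(2 * y + 1) * ?h = \<delta> r * y + ?h" using \<delta>_facts(1)[OF r] by (auto elim!: evenE)
  hence "int g ^ (ord (l ^ r) q * ?h) = int (g ^ \<delta> r) ^ y * int g ^ ?h"
    by (simp only: y power_add power_mult of_nat_power)
  hence "[int (g ^ \<delta> r) ^ y * int g ^ ?h = - 1] (mod int (l ^ r))"
    using generator_half[OF r] by simp
  moreover have "[int (g ^ \<delta> r) ^ y * int g ^ ?h = int (q ^ a) ^ y * int g ^ ?h] (mod int (l ^ r))"
    using a by (intro cong_mult cong_pow cong_refl) (simp only: cong_int_iff)
  ultimately have "[int (q ^ (a * y)) * int g ^ ?h = - 1] (mod int (l ^ r))"
    by (simp add: cong_def power_mult)
  hence "[int (q ^ b) * (int (q ^ (a * y)) * int g ^ ?h) = int (q ^ b) * - 1] (mod int (l ^ r))"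
    by (rule cong_scalar_left)
  moreover have "[int (q ^ (a * y) * q ^ b) * int g ^ ?h = int 1 * int g ^ ?h] (mod int (l ^ r))"
    using b by (intro cong_mult cong_refl) (simp only: cong_int_iff)
  ultimately have "[int g ^ ?h = - (int q ^ b)] (mod int (l ^ r))"
    by (simp add: cong_def ac_simps)
  thus ?thesis by (rule that)
qed

text \<open>Reduce the exponent of \<open>g\<close> modulo \<open>\<delta> r\<close> at the cost of
  a power of \<open>q\<close>, and then modulo \<open>\<delta> r div 2\<close> at the cost of a
  sign.\<close>

lemma unit_cover:
  assumes r: "0 < r" "r \<le> m" and u: "coprime u (int l)"
  obtains k i where "k < \<delta> r div 2"
    "[u = int g ^ k * int q ^ i] (mod int (l ^ r)) \<or> [u = - (int g ^ k) * int q ^ i] (mod int (l ^ r))"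
proof -
  obtain j where j: "[u = int g ^ j] (mod int (l ^ r))" using generator_powers[OF r(2) u] .
  obtain a where a: "[g ^ \<delta> r = q ^ a] (mod l ^ r)" using generator_power_\<delta>[OF r(2)] .
  define x where "x = j div \<delta> r"
  define k where "k = j mod \<delta> r"
  have "j = \<delta> r * x + k" by (simp add: x_def k_def)
  hence "int g ^ j = int (g ^ \<delta> r) ^ x * int g ^ k" by (simp add: power_add power_mult)
  also have "[\<dots> = int (q ^ a) ^ x * int g ^ k] (mod int (l ^ r))"
    using a by (intro cong_mult cong_pow cong_refl) (simp only: cong_int_iff)
  finally have gj: "[u = int g ^ k * int q ^ (a * x)] (mod int (l ^ r))"
    using j by (simp add: cong_def power_mult mult.commute)
  show ?thesis
  proof (cases "k < \<delta> r div 2")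
    case True
    thus ?thesis using gj that by blast
  next
    case False
    define k' where "k' = k - \<delta> r div 2"
    have k: "k = k' + \<delta> r div 2" using False by (simp add: k'_def)
    have "k < \<delta> r" using \<delta>_facts(4)[OF r] by (simp add: k_def)
    hence k': "k' < \<delta> r div 2" using \<delta>_facts(1)[OF r] k by (auto elim!: evenE)
    obtain b where b: "[int g ^ (\<delta> r div 2) = - (int q ^ b)] (mod int (l ^ r))"
      using generator_half_\<delta>[OF r] .
    have "[int g ^ k' * int g ^ (\<delta> r div 2) * int q ^ (a * x) = int g ^ k' * - (int q ^ b) * int q ^ (a * x)]
      (mod int (l ^ r))" by (intro cong_mult b cong_refl)
    with gj have "[u = int g ^ k' * - (int q ^ b) * int q ^ (a * x)] (mod int (l ^ r))"
      unfolding k power_add by (rule cong_trans)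
    also have "int g ^ k' * - (int q ^ b) * int q ^ (a * x) = - (int g ^ k') * int q ^ (b + a * x)"
      by (simp add: power_add)
    finally show ?thesis using that k' by blast
  qed
qed

text \<open>Compare exponents of \<open>g\<close>: those of \<open>q\<close> and of -1 are both
  multiples of \<open>\<delta> r div 2\<close>, so \<open>k\<close> and \<open>k'\<close> agree
  modulo \<open>\<delta> r div 2\<close>, and both lie below it.\<close>

lemma unit_unique:
  assumes r: "0 < r" "r \<le> m" and k: "k < \<delta> r div 2" "k' < \<delta> r div 2"
    and "[int g ^ k = int g ^ k' * int q ^ i] (mod int (l ^ r)) \<or>
      [int g ^ k = - (int g ^ k') * int q ^ i] (mod int (l ^ r))"
  shows "k = k'"
proof -
  let ?H = "ord (l ^ r) q * (\<delta> r div 2)"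
  obtain c where c: "[q = g ^ c] (mod l ^ r)" "\<delta> r = gcd c (totient (l ^ r))"
    using q_as_generator_power[OF r(2)] .
  have "[int q ^ i = int (g ^ c) ^ i] (mod int (l ^ r))"
    using c(1) by (intro cong_pow) (simp only: cong_int_iff)
  hence qi: "[int q ^ i = int g ^ (c * i)] (mod int (l ^ r))" by (simp add: power_mult)
  have 1: "[x * int q ^ i = x * int g ^ (c * i)] (mod int (l ^ r))" for x
    by (rule cong_scalar_left[OF qi])
  have 2: "[- (int g ^ k') = int g ^ ?H * int g ^ k'] (mod int (l ^ r))"
    using cong_mult[OF generator_half[OF r] cong_refl[of "int g ^ k'"]] by (simp add: cong_sym_eq)
  have "\<exists>h\<in>{0, ?H}. [int g ^ k = int g ^ h * int g ^ k' * int g ^ (c * i)] (mod int (l ^ r))"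
    using assms(5)
  proof
    assume "[int g ^ k = int g ^ k' * int q ^ i] (mod int (l ^ r))"
    thus ?thesis using 1[of "int g ^ k'"] by (intro bexI[of _ 0]) (auto intro: cong_trans)
  next
    assume "[int g ^ k = - (int g ^ k') * int q ^ i] (mod int (l ^ r))"
    moreover have "[- (int g ^ k') * int q ^ i = int g ^ ?H * int g ^ k' * int g ^ (c * i)] (mod int (l ^ r))"
      by (rule cong_mult[OF 2 qi])
    ultimately show ?thesis by (intro bexI[of _ ?H]) (auto intro: cong_trans)
  qed
  then obtain h where h: "h \<in> {0, ?H}"
    and "[int g ^ k = int g ^ h * int g ^ k' * int g ^ (c * i)] (mod int (l ^ r))" by blast
  hence "[int (g ^ k) = int (g ^ (h + k' + c * i))] (mod int (l ^ r))" by (simp add: power_add)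
  hence "[g ^ k = g ^ (h + k' + c * i)] (mod l ^ r)" by (simp only: cong_int_iff)
  hence 3: "[k = h + k' + c * i] (mod totient (l ^ r))"
    using g_cop ord_generator[OF r(2)] order_divides_expdiff[of "l ^ r" g k "h + k' + c * i"]
    by (simp add: coprime_commute)
  have half: "\<delta> r div 2 dvd \<delta> r" using \<delta>_facts(1)[OF r] by auto
  moreover have "\<delta> r dvd totient (l ^ r)" "\<delta> r dvd c" by (simp_all add: c(2))
  ultimately have dvd: "\<delta> r div 2 dvd totient (l ^ r)" "\<delta> r div 2 dvd c" by (metis dvd_trans)+
  have "[k = h + k' + c * i] (mod \<delta> r div 2)" using 3 dvd(1) by (rule cong_dvd_modulus_nat)
  moreover have "\<delta> r div 2 dvd c * i" "\<delta> r div 2 dvd h" using dvd(2) h by auto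
  ultimately have "[k = k'] (mod \<delta> r div 2)" by (auto simp: cong_def elim!: dvdE)
  thus ?thesis using k by (simp add: cong_def)
qed

text \<open>The single index at level 0 stands for the coset of 0, so that the factors X - 1 and X +
  1 are treated together with the others.\<close>

definition idx :: "(nat \<times> nat) set" where
  "idx = (SIGMA r:{0..m}. if r = 0 then {0} else {..<\<delta> r div 2})"

definition rep :: "nat \<times> nat \<Rightarrow> int" where
  "rep = (\<lambda>(r, k). if r = 0 then 0 else int (l ^ (m - r) * g ^ k))"

lemma finite_idx: "finite idx"
  by (auto simp: idx_def)

lemma cong_scale:
  assumes "r \<le> m"
  shows "[int l ^ (m - r) * x = int l ^ (m - r) * y] (mod int (l ^ m)) \<longleftrightarrow> [x = y] (mod int (l ^ r))"
proof -
  have "int (l ^ m) = int l ^ (m - r) * int l ^ r"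
    using assms by (simp add: power_add[symmetric])
  thus ?thesis using l_gt_1
    by (simp add: cong_iff_dvd_diff right_diff_distrib[symmetric])
qed

text \<open>Split off the full power \<open>l ^ j\<close> of \<open>t\<close>; the remaining unit is
  covered at level \<open>m - j\<close>. Multiples of \<open>l ^ m\<close> belong to the index
  \<open>(0, 0)\<close>.\<close>

lemma rep_cover:
  obtains x where "x \<in> idx" "rel t (rep x) \<or> rel t (- rep x)"
proof (cases "int (l ^ m) dvd t")
  case True
  hence "rel t (rep (0, 0))" by (intro relI) (simp add: rep_def cong_0_iff)
  thus ?thesis using that[of "(0, 0)"] by (simp add: idx_def)
next
  case False
  define j where "j = multiplicity (int l) t"
  have t0: "t \<noteq> 0" using False by auto
  have pl: "prime (int l)" using l_prime by simp
  obtain u where u: "t = int l ^ j * u" "\<not> int l dvd u"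
    using multiplicity_decompose'[of t "int l"] t0 pl unfolding j_def
    by (metis not_prime_unit)
  have jm: "j < m"
  proof (rule ccontr)
    assume "\<not> j < m"
    hence "int l ^ m dvd int l ^ j" by (simp add: le_imp_power_dvd)
    thus False using False u by simp
  qed
  define r where "r = m - j"
  have r: "0 < r" "r \<le> m" "j = m - r" using jm by (auto simp: r_def)
  have "coprime u (int l)" using u(2) pl by (metis prime_imp_coprime coprime_commute)
  from unit_cover[OF r(1,2) this] obtain k i where k: "k < \<delta> r div 2"
    "[u = int g ^ k * int q ^ i] (mod int (l ^ r)) \<or> [u = - (int g ^ k) * int q ^ i] (mod int (l ^ r))" .
  have rep: "rep (r, k) = int l ^ (m - r) * int g ^ k" using r by (simp add: rep_def)
  have "(r, k) \<in> idx" using r k by (simp add: idx_def)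
  moreover have "rel t (rep (r, k)) \<or> rel t (- rep (r, k))"
    using k(2)
  proof
    assume "[u = int g ^ k * int q ^ i] (mod int (l ^ r))"
    hence "rel t (rep (r, k))" unfolding u(1) rep r(3)
      by (intro relI[of _ _ i]) (simp add: mult.assoc cong_scale[OF r(2), simplified])
    thus ?thesis ..
  next
    assume "[u = - (int g ^ k) * int q ^ i] (mod int (l ^ r))"
    hence "[int l ^ (m - r) * u = int l ^ (m - r) * (- (int g ^ k) * int q ^ i)] (mod int (l ^ m))"
      by (simp only: cong_scale[OF r(2)])
    hence "rel t (- rep (r, k))" unfolding u(1) rep r(3)
      by (intro relI[of _ _ i]) (simp add: mult.assoc)
    thus ?thesis ..
  qed
  ultimately show ?thesis by (rule that)
qed

text \<open>At a smaller level the representative is divisible by a higher power of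
  \<open>l\<close>, so the levels agree; \<open>unit_unique\<close> then compares the exponents of
  \<open>g\<close>.\<close>

lemma rep_unique:
  assumes "x \<in> idx" "y \<in> idx" "rel (rep x) (rep y) \<or> rel (rep x) (- rep y)"
  shows "x = y"
proof -
  have less: False if "(r, k) \<in> idx" "(r', k') \<in> idx" "r < r'"
    "rel (rep (r, k)) (rep (r', k')) \<or> rel (rep (r, k)) (- rep (r', k'))" for r k r' k'
  proof -
    have r': "0 < r'" "r' \<le> m" using that by (auto simp: idx_def)
    have "int l ^ (m - r) dvd rep (r, k)" by (simp add: rep_def)
    hence "int l ^ (m - r) dvd rep (r', k')"
      using that(4) rel_dvd[of "rep (r, k)" _ "m - r"] by fastforce
    moreover have "int l ^ Suc (m - r') dvd int l ^ (m - r)"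
      using that(3) r' by (intro le_imp_power_dvd) auto
    ultimately have "int l ^ Suc (m - r') dvd rep (r', k')" by (rule dvd_trans[rotated])
    hence "int l ^ (m - r') * int l dvd int l ^ (m - r') * int g ^ k'"
      using r' by (simp add: rep_def mult.commute)
    hence "int l dvd int (g ^ k')" using l_gt_1 by simp
    hence "l dvd g ^ k'" by (simp only: int_dvd_int_iff)
    hence "l dvd g" using l_prime prime_dvd_power by blast
    thus False using g_cop l_prime by (meson coprime_common_divisor not_prime_unit dvd_refl)
  qed
  obtain r k r' k' where xy: "x = (r, k)" "y = (r', k')" by fastforce
  have sym: "rel (rep y) (rep x) \<or> rel (rep y) (- rep x)"
    using assms(3) rel_sym rel_minus[of "rep x" "- rep y"] by fastforce
  have rr: "r = r'"
    using less[of r k r' k'] less[of r' k' r k] assms sym unfolding xy by (metis linorder_neqE_nat)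
  show ?thesis
  proof (cases "r = 0")
    case True
    thus ?thesis using assms rr by (simp add: xy idx_def)
  next
    case False
    hence r: "0 < r" "r \<le> m" and k: "k < \<delta> r div 2" "k' < \<delta> r div 2"
      using assms rr by (auto simp: xy idx_def)
    obtain i where "[rep x = rep y * int q ^ i] (mod int (l ^ m)) \<or>
        [rep x = - rep y * int q ^ i] (mod int (l ^ m))"
      using assms(3) by (auto simp: rel_def)
    hence "[int g ^ k = int g ^ k' * int q ^ i] (mod int (l ^ r)) \<or>
        [int g ^ k = - (int g ^ k') * int q ^ i] (mod int (l ^ r))"
      using False rr cong_scale[OF r(2), of "int g ^ k" "int g ^ k' * int q ^ i"]
        cong_scale[OF r(2), of "int g ^ k" "- (int g ^ k') * int q ^ i"]
      by (simp add: xy rep_def mult.assoc)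
    thus ?thesis using unit_unique[OF r k] xy rr by blast
  qed
qed

text \<open>Cancelling the power of \<open>l\<close> and the unit \<open>g ^ k\<close> would make -1
  a power of \<open>q\<close> modulo \<open>l\<close>.\<close>

lemma rep_not_rel_minus:
  assumes "x \<in> idx" "x \<noteq> (0, 0)"
  shows "\<not> rel (rep x) (- rep x)"
proof
  assume "rel (rep x) (- rep x)"
  then obtain i where i: "[rep x = - rep x * int q ^ i] (mod int (l ^ m))" by (auto simp: rel_def)
  obtain r k where x: "x = (r, k)" by fastforce
  have r: "0 < r" "r \<le> m" using assms by (auto simp: idx_def x split: if_splits)
  have "[int g ^ k * 1 = int g ^ k * - (int q ^ i)] (mod int (l ^ r))"
    using i cong_scale[OF r(2), of "int g ^ k" "int g ^ k * - (int q ^ i)"] r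
    by (simp add: x rep_def mult.assoc)
  hence "[1 = - (int q ^ i)] (mod int (l ^ r))"
    using g_cop by (subst (asm) cong_mult_lcancel) auto
  hence "[1 = - (int q ^ i)] (mod int l)"
    by (rule cong_dvd_modulus) (use r in \<open>simp add: dvd_power\<close>)
  hence "[int q ^ i = - 1] (mod int l)"
    by (metis cong_minus_minus_iff cong_sym minus_minus)
  thus False using odd_ord_imp_not_cong_minus_one[OF l_prime l_odd ord_odd] by blast
qed

text \<open>The index \<open>(0, 0)\<close> yields one coset and every other index two, one per
  sign. With \<open>e + 1\<close> cosets this makes \<open>2 * card idx\<close> equal to
  \<open>e + 2\<close>.\<close>

lemma card_cosets: "Suc (card {cyclo_coset q (l ^ m) t | t. True}) = 2 * card idx"
proof -
  let ?c = "cyclo_coset q (l ^ m)"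
  let ?I = "idx - {(0, 0)}"
  have 0: "(0, 0) \<in> idx" "rep (0, 0) = 0" by (auto simp: idx_def rep_def)
  have "{?c t | t. True} = (\<lambda>x. ?c (rep x)) ` idx \<union> (\<lambda>x. ?c (- rep x)) ` ?I" (is "_ = ?A \<union> ?B")
  proof (intro equalityI subsetI)
    fix C assume "C \<in> {?c t | t. True}"
    then obtain t where C: "C = ?c t" by blast
    obtain x where x: "x \<in> idx" "rel t (rep x) \<or> rel t (- rep x)" by (rule rep_cover)
    show "C \<in> ?A \<union> ?B"
    proof (cases "rel t (rep x)")
      case True
      thus ?thesis using x C cyclo_coset_eq_iff by blast
    next
      case False
      hence "x \<noteq> (0, 0)" using x 0 by auto
      thus ?thesis using False x C cyclo_coset_eq_iff by blast
    qed
  qed blast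
  moreover have "card ?A = card idx"
    by (intro card_image inj_onI rep_unique) (auto simp: cyclo_coset_eq_iff)
  moreover have "card ?B = card ?I"
    by (intro card_image inj_onI rep_unique) (auto simp: cyclo_coset_eq_iff dest: rel_minus)
  moreover have "?A \<inter> ?B = {}"
  proof (rule ccontr)
    assume "?A \<inter> ?B \<noteq> {}"
    then obtain x y where xy: "x \<in> idx" "y \<in> ?I" "rel (rep x) (- rep y)"
      unfolding cyclo_coset_eq_iff[symmetric] by blast
    hence "x = y" using rep_unique by blast
    thus False using rep_not_rel_minus xy by auto
  qed
  ultimately have "card {?c t | t. True} = card idx + card ?I"
    using finite_idx by (simp add: card_Un_disjoint)
  moreover have "card idx = Suc (card ?I)"
    using 0(1) finite_idx by (metis card.remove)
  ultimately show ?thesis by simp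
qed

end

section \<open>The roots of unity of order dividing $2 l^m$\<close>

text \<open>Each linear factor contributes a sign, and this sign is what \<open>hatp\<close>
  removes.\<close>

lemma negX_root_poly:
  "negX (root_poly S) = smult ((- 1) ^ card S) (root_poly (uminus ` S))"
proof -
  have "negX (root_poly S) = (\<Prod>z\<in>S. smult (- 1) [:- (- z), 1:])"
    unfolding negX_def root_poly_def pcompose_prod by (intro prod.cong) (auto simp: pcompose_pCons)
  also have "\<dots> = smult (\<Prod>z\<in>S. - 1) (\<Prod>z\<in>S. [:- (- z), 1:])"
    by (rule prod_smult)
  also have "(\<Prod>z\<in>S. [:- (- z), 1:]) = root_poly (uminus ` S)"
    unfolding root_poly_def by (subst prod.reindex) (auto intro: inj_onI)
  finally show ?thesis by simp
qed

lemma hatp_smult_root_poly: "c \<noteq> 0 \<Longrightarrow> hatp (smult c (root_poly S)) = root_poly S"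
  using lead_coeff_root_poly[of S] by (simp add: hatp_def)

context finite_field_embedding
begin

lemma E_hatp: "E (hatp a) = hatp (E a)"
proof -
  have "emb (inverse x) = inverse (emb x)" for x
  proof (cases "x = 0")
    case False
    hence "emb x * emb (inverse x) = 1" by (simp add: emb_hom(2,4)[symmetric])
    thus ?thesis by (simp add: inverse_unique)
  qed (simp add: emb_hom)
  thus ?thesis by (simp add: hatp_def E_smult coeff_map_poly emb_hom)
qed

lemma E_negX: "E (negX a) = negX (E a)"
proof (induction a)
  case (pCons c a)
  have add: "E (x + y) = E x + E y" for x y
    by (rule poly_eqI) (simp add: coeff_map_poly emb_hom)
  have "E [:0, - 1:] = [:0, - 1:]" by (simp add: map_poly_pCons emb_hom emb_uminus)
  thus ?case using pCons.IH
    by (simp only: negX_def pcompose_pCons add E_mult map_poly_pCons emb_hom(1) map_poly_0)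
qed (simp add: negX_def)

end

locale prime_power_roots =
  finite_field_embedding emb p s + prime_power_generator l m "p ^ s" g
  for emb :: "'a::{field,finite} \<Rightarrow> 'b::field" and p s l m g :: nat +
  fixes \<eta> :: 'b and n :: nat
  assumes p_odd: "odd p"
    and eta_prim: "\<eta> ^ (l ^ m) = 1" "\<And>j. 0 < j \<Longrightarrow> j < l ^ m \<Longrightarrow> \<eta> ^ j \<noteq> 1"
begin

lemma lm_pos: "l ^ m > 0" using l_gt_1 by simp

lemma eta_nonzero: "\<eta> \<noteq> 0"
  using eta_prim(1) lm_pos by (metis power_0_left less_irrefl zero_neq_one)

text \<open>Integer exponents accommodate the negative representatives; \<open>minpoly_M\<close>
  uses their residues as natural exponents.\<close>

lemma eta_powi_mod: "\<eta> powi t = \<eta> ^ nat (t mod int (l ^ m))"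
proof -
  have "\<eta> powi t = \<eta> powi (int (l ^ m) * (t div int (l ^ m)) + t mod int (l ^ m))" by simp
  also have "\<dots> = (\<eta> powi int (l ^ m)) powi (t div int (l ^ m)) * \<eta> powi (t mod int (l ^ m))"
    by (subst power_int_add) (simp_all only: eta_nonzero power_int_mult simp_thms not_False_eq_True)
  also have "\<eta> powi int (l ^ m) = 1" using eta_prim(1) by (simp only: power_int_of_nat)
  finally show ?thesis using lm_pos by (simp add: power_int_def)
qed

lemma eta_powi_eq_iff: "\<eta> powi a = \<eta> powi b \<longleftrightarrow> [a = b] (mod int (l ^ m))"
proof -
  have "\<eta> powi a = \<eta> powi b \<longleftrightarrow> \<eta> powi (a - b) = 1"
    using eta_nonzero by (simp add: power_int_diff)
  also have "\<dots> \<longleftrightarrow> nat ((a - b) mod int (l ^ m)) = 0"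
  proof -
    have "nat ((a - b) mod int (l ^ m)) < l ^ m"
      using lm_pos by (metis nat_less_iff of_nat_0_less_iff pos_mod_bound pos_mod_sign)
    thus ?thesis unfolding eta_powi_mod using eta_prim(2) by (metis gr0I power_0)
  qed
  also have "\<dots> \<longleftrightarrow> (a - b) mod int (l ^ m) = 0"
    using lm_pos by (metis nat_0_iff of_nat_0_less_iff order_antisym pos_mod_sign order_refl)
  finally show ?thesis by (simp add: cong_iff_dvd_diff dvd_eq_mod_eq_0)
qed

lemma minus_one_neq_one: "(1::'b) \<noteq> - 1"
proof
  assume "(1::'b) = - 1"
  hence "of_nat 2 = (0::'b)" by (simp add: eq_neg_iff_add_eq_0)
  hence "p dvd 2" by (simp only: of_nat_eq_0_iff_char_dvd CHAR_b)
  thus False using p_prime p_odd by (metis primes_dvd_imp_eq two_is_prime_nat even_numeral dvd_refl)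
qed

text \<open>Raising to the odd power \<open>l ^ m\<close> sends the left side to 1 and the right
  side to -1.\<close>

lemma eta_powi_neq_minus: "\<eta> powi a \<noteq> - (\<eta> powi b)"
proof
  assume eq: "\<eta> powi a = - (\<eta> powi b)"
  have one: "(\<eta> powi t) ^ (l ^ m) = 1" for t
    unfolding eta_powi_mod using eta_prim(1) by (metis mult.commute power_mult power_one)
  have "(- (\<eta> powi b)) ^ (l ^ m) = - 1" using l_odd one[of b] by simp
  thus False using one[of a] eq minus_one_neq_one by simp
qed

text \<open>The \<open>l ^ m\<close> powers of \<open>\<eta>\<close> and their negatives are already
  as many roots as the degree allows.\<close>

lemma roots_of_unity:
  "{z::'b. z ^ (2 * l ^ m) = 1} = range (\<lambda>t. \<eta> powi t) \<union> range (\<lambda>t. - (\<eta> powi t))"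
  "card {z::'b. z ^ (2 * l ^ m) = 1} = 2 * l ^ m"
proof -
  let ?U = "{z::'b. z ^ (2 * l ^ m) = 1}"
  let ?A = "(\<lambda>x::nat. \<eta> powi int x) ` {..<l ^ m}"
  let ?f = "monom 1 (2 * l ^ m) - 1 :: 'b poly"
  have nz: "?f \<noteq> 0" using xn1_neq_0[of "2 * l ^ m", where 'a='b] lm_pos by (simp add: xn1_def)
  have roots: "?U = {z. poly ?f z = 0}" by (auto simp: poly_monom)
  have fin: "finite ?U" unfolding roots by (rule poly_roots_finite[OF nz])
  have ub: "card ?U \<le> 2 * l ^ m" unfolding roots
    using card_poly_roots_bound[OF nz] degree_xn1[of "2 * l ^ m", where 'a='b] lm_pos
    by (simp add: xn1_def)
  have one: "(\<eta> powi t) ^ (2 * l ^ m) = 1" for t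
    unfolding eta_powi_mod using eta_prim(1) by (metis mult.commute power_mult power_one)
  have sub: "range (\<lambda>t. \<eta> powi t) \<union> range (\<lambda>t. - (\<eta> powi t)) \<subseteq> ?U"
    using one by auto
  have subA: "?A \<union> uminus ` ?A \<subseteq> range (\<lambda>t. \<eta> powi t) \<union> range (\<lambda>t. - (\<eta> powi t))" by blast
  have "inj_on (\<lambda>x::nat. \<eta> powi int x) {..<l ^ m}"
  proof (rule inj_onI)
    fix x y assume xy: "x \<in> {..<l ^ m}" "y \<in> {..<l ^ m}" "\<eta> powi int x = \<eta> powi int y"
    hence "[x = y] (mod l ^ m)" by (simp only: eta_powi_eq_iff cong_int_iff)
    thus "x = y" using xy by (simp add: cong_def)
  qed
  hence "card ?A = l ^ m" by (simp add: card_image)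
  moreover have "card (uminus ` ?A) = card ?A" by (rule card_image) (auto intro: inj_onI)
  moreover have "?A \<inter> uminus ` ?A = {}" using eta_powi_neq_minus by blast
  ultimately have "card (?A \<union> uminus ` ?A) = 2 * l ^ m" by (simp add: card_Un_disjoint)
  hence eq: "?A \<union> uminus ` ?A = ?U"
    using ub fin by (intro card_seteq subset_trans[OF subA sub]) simp_all
  thus "card ?U = 2 * l ^ m" using \<open>card (?A \<union> uminus ` ?A) = 2 * l ^ m\<close> by simp
  show "?U = range (\<lambda>t. \<eta> powi t) \<union> range (\<lambda>t. - (\<eta> powi t))" using eq sub subA by blast
qed

sublocale cyclic_length emb p s "2 * l ^ m" n
  by unfold_locales (use lm_pos roots_of_unity in auto)

definition Z :: "int \<Rightarrow> 'b set" where
  "Z t = {\<eta> powi (t * int q ^ i) | i. True}"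

lemma powi_in_Z: "\<eta> powi u \<in> Z t \<longleftrightarrow> rel u t"
  by (auto simp: Z_def rel_def eta_powi_eq_iff)

lemma Z_eq: "rel t u \<Longrightarrow> Z t = Z u"
proof -
  have "Z t = (\<lambda>v. \<eta> powi v) ` {v. rel v t}" for t
  proof (intro equalityI subsetI)
    fix z assume "z \<in> Z t"
    moreover from this obtain v where "z = \<eta> powi v" by (auto simp: Z_def)
    ultimately show "z \<in> (\<lambda>v. \<eta> powi v) ` {v. rel v t}" by (auto simp: powi_in_Z)
  qed (auto simp: powi_in_Z)
  moreover assume "rel t u"
  hence "rel v t \<longleftrightarrow> rel v u" for v using rel_trans rel_sym by blast
  ultimately show ?thesis by simp
qed

lemma Z_subset_U: "Z t \<subseteq> U"
  unfolding roots_of_unity(1) by (auto simp: Z_def)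

lemma finite_Z: "finite (Z t)"
  by (rule finite_subset_U[OF Z_subset_U])

lemma Z_frob: "z \<in> Z t \<Longrightarrow> z ^ q \<in> Z t"
proof -
  assume "z \<in> Z t"
  then obtain i where "z = \<eta> powi (t * int q ^ i)" by (auto simp: Z_def)
  hence "z ^ q = \<eta> powi (t * int q ^ Suc i)"
    by (simp add: power_int_mult[symmetric] power_int_of_nat[symmetric] ac_simps del: power_int_of_nat)
  thus ?thesis unfolding Z_def by blast
qed

lemma Z_inverse: "z \<in> Z t \<Longrightarrow> inverse z \<in> Z (- t)"
  by (auto simp: Z_def power_int_minus)

lemma Z_orbit:
  assumes "z \<in> Z t" "w \<in> Z t"
  obtains i where "w = z ^ (q ^ i)"
proof -
  obtain a b where ab: "z = \<eta> powi a" "w = \<eta> powi b" "rel a t" "rel b t"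
  proof -
    obtain a b where "z = \<eta> powi a" "w = \<eta> powi b" using assms by (auto simp: Z_def)
    thus ?thesis using that assms powi_in_Z by blast
  qed
  then obtain i where "[b = a * int q ^ i] (mod int (l ^ m))"
    using rel_trans[OF ab(4) rel_sym[OF ab(3)]] by (auto simp: rel_def)
  hence "w = \<eta> powi (a * int (q ^ i))" by (simp add: ab eta_powi_eq_iff)
  also have "\<dots> = z ^ (q ^ i)" unfolding ab(1) by (simp only: power_int_mult power_int_of_nat)
  finally show ?thesis by (rule that)
qed

section \<open>Minimal polynomials of the powers of the primitive root\<close>

abbreviation "M \<equiv> minpoly_M emb \<eta> q (l ^ m)"

text \<open>The product over a coset descends because Frobenius preserves \<open>Z t\<close>, and
  injectivity of \<open>E\<close> makes the descended polynomial unique. So the definite description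
  in \<open>minpoly_M\<close> denotes it.\<close>

lemma E_M: "E (M t) = root_poly (Z t)"
proof -
  have im: "Z t = (\<lambda>x. \<eta> ^ x) ` cyclo_coset q (l ^ m) t"
    by (auto simp: Z_def cyclo_coset_def eta_powi_mod)
  have "inj_on (\<lambda>x. \<eta> ^ x) (cyclo_coset q (l ^ m) t)"
  proof (rule inj_onI)
    fix x y assume xy: "x \<in> cyclo_coset q (l ^ m) t" "y \<in> cyclo_coset q (l ^ m) t" "\<eta> ^ x = \<eta> ^ y"
    have lt: "c < l ^ m" if "c \<in> cyclo_coset q (l ^ m) t" for c
      using that lm_pos unfolding cyclo_coset_def
      by (auto simp: nat_less_iff simp del: of_nat_power)
    have "\<eta> powi int x = \<eta> powi int y" using xy(3) by simp
    hence "[x = y] (mod l ^ m)" by (simp only: eta_powi_eq_iff cong_int_iff)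
    thus "x = y" using lt xy by (simp add: cong_def)
  qed
  hence eq: "(\<Prod>x\<in>cyclo_coset q (l ^ m) t. [:- (\<eta> ^ x), 1:]) = root_poly (Z t)"
    unfolding im root_poly_def by (simp add: prod.reindex)
  obtain Q where Q: "E Q = root_poly (Z t)" using root_poly_descends[OF finite_Z Z_frob] .
  have "M t = Q" unfolding minpoly_M_def eq
    by (rule the_equality) (use Q in simp, metis Q inj_E injD)
  thus ?thesis using Q by simp
qed

lemma hatp_M: "hatp (M t) = M t"
  by (rule injD[OF inj_E]) (use E_hatp[of "M t"] hatp_smult_root_poly[of 1 "Z t"] in \<open>simp add: E_M\<close>)

lemma E_hatp_negX:
  assumes "E a = root_poly S"
  shows "E (hatp (negX a)) = root_poly (uminus ` S)"
  by (simp add: E_hatp E_negX assms negX_root_poly hatp_smult_root_poly)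

text \<open>The common core of both parities: each representative up to sign gives one
  inversion-stable block among the powers of \<open>\<eta>\<close>, and a second one consisting of
  the negatives.\<close>

lemma LCD_codes_of_representatives:
  fixes X :: "'t set" and a :: "'t \<Rightarrow> int" and Q Q' :: "'t \<Rightarrow> 'a poly"
  assumes X: "finite X"
    and cover: "\<And>t. \<exists>x\<in>X. rel t (a x) \<or> rel t (- a x)"
    and uniq: "\<And>x y. x \<in> X \<Longrightarrow> y \<in> X \<Longrightarrow> rel (a x) (a y) \<or> rel (a x) (- a y) \<Longrightarrow> x = y"
    and Q: "\<And>x. x \<in> X \<Longrightarrow> E (Q x) = root_poly (Z (a x) \<union> Z (- a x))"
    and Q': "\<And>x. x \<in> X \<Longrightarrow> E (Q' x) = root_poly (uminus ` (Z (a x) \<union> Z (- a x)))"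
  shows "{C. cyclic_code N C \<and> LCD N C} =
      {code_gen N (\<Prod>x\<in>X. Q x ^ \<epsilon> x * Q' x ^ \<sigma> x) | \<epsilon> \<sigma>. \<forall>x\<in>X. \<epsilon> x \<in> {0, P} \<and> \<sigma> x \<in> {0, P}}"
    and "card {C :: 'a poly set. cyclic_code N C \<and> LCD N C} = 2 ^ (2 * card X)"
proof -
  define V where "V x = Z (a x) \<union> Z (- a x)" for x
  \<comment> \<open>The Boolean selects between powers of \<open>\<eta>\<close> and their negatives,
    that is, between the roots of X^(l^m) - 1 and of X^(l^m) + 1.\<close>
  define T where "T = (UNIV :: bool set) \<times> X"
  define B where "B = (\<lambda>(b, x). if b then V x else uminus ` V x)"
  define R where "R = (\<lambda>(b, x). if b then Q x else Q' x)"
  have powi_V: "\<eta> powi t \<in> V x \<longleftrightarrow> rel t (a x) \<or> rel t (- a x)" for t x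
    by (simp add: V_def powi_in_Z)
  have V_powi: "\<exists>t. z = \<eta> powi t" if "z \<in> V x" for z x
    using that by (auto simp: V_def Z_def)
  have V_inv: "inverse z \<in> V x" if "z \<in> V x" for z x
    using that Z_inverse[of z "a x"] Z_inverse[of z "- a x"] by (auto simp: V_def)
  have V_orbit: "\<exists>i. w = z ^ (q ^ i) \<or> w = inverse z ^ (q ^ i)" if "z \<in> V x" "w \<in> V x" for z w x
    using that Z_inverse[of z "a x"] Z_inverse[of z "- a x"] unfolding V_def
    by (metis UnE Z_orbit minus_minus)
  have V_disj: "x = y" if xy: "x \<in> X" "y \<in> X" "z \<in> V x" "z \<in> V y" for x y z
  proof -
    obtain t where t: "z = \<eta> powi t" using V_powi xy by blast
    have "rel t (a x) \<or> rel t (- a x)" "rel t (a y) \<or> rel t (- a y)"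
      using xy t powi_V by auto
    hence "rel (a x) (a y) \<or> rel (a x) (- a y)"
      by (metis rel_sym rel_trans rel_minus minus_minus)
    thus ?thesis using uniq xy by blast
  qed
  have T: "finite T" using X by (simp add: T_def)
  have cov: "(\<Union>t\<in>T. B t) = U"
  proof (intro equalityI subsetI)
    fix z assume "z \<in> (\<Union>t\<in>T. B t)"
    then obtain b x where "z \<in> B (b, x)" by (auto simp: T_def)
    hence "z \<in> V x \<or> - z \<in> V x" by (auto simp: B_def split: if_splits)
    hence "(\<exists>t. z = \<eta> powi t) \<or> (\<exists>t. - z = \<eta> powi t)" using V_powi by blast
    thus "z \<in> U" unfolding roots_of_unity(1) by (auto simp: minus_equation_iff[of z])
  next
    fix z assume "z \<in> U"
    then obtain t where t: "z = \<eta> powi t \<or> z = - (\<eta> powi t)" unfolding roots_of_unity(1) by blast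
    obtain x where "x \<in> X" "\<eta> powi t \<in> V x" using cover[of t] powi_V by blast
    hence "z \<in> B (z = \<eta> powi t, x) \<and> (z = \<eta> powi t, x) \<in> T"
      using t by (auto simp: T_def B_def)
    thus "z \<in> (\<Union>t\<in>T. B t)" by blast
  qed
  have cross: "z \<notin> uminus ` V y" if "z \<in> V x" for x y z
  proof
    assume "z \<in> uminus ` V y"
    then obtain w where "w \<in> V y" "z = - w" by blast
    thus False using V_powi[OF that] V_powi[of w y] eta_powi_neq_minus by metis
  qed
  have disj: "B t \<inter> B u = {}" if tu: "t \<in> T" "u \<in> T" "t \<noteq> u" for t u
  proof (rule ccontr)
    assume "B t \<inter> B u \<noteq> {}"
    then obtain z where z: "z \<in> B t" "z \<in> B u" by blast
    obtain b x b' y where t: "t = (b, x)" "u = (b', y)" by fastforce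
    have "b = b'" using z cross by (auto simp: t B_def split: if_splits)
    moreover have "x = y"
      using z tu V_disj cross by (auto simp: t B_def T_def split: if_splits)
    ultimately show False using tu t by simp
  qed
  have ne: "B t \<noteq> {}" if "t \<in> T" for t
    using powi_V[of "a (snd t)" "snd t"] rel_refl by (auto simp: B_def split: prod.splits)
  have ER: "E (R t) = root_poly (B t)" if "t \<in> T" for t
    using that Q Q' by (auto simp: T_def R_def B_def V_def)
  have inv: "inverse z \<in> B t" if "t \<in> T" "z \<in> B t" for t z
    using that V_inv by (auto simp: B_def split: prod.splits if_splits)
  have orb: "\<exists>i. w = z ^ (q ^ i) \<or> w = inverse z ^ (q ^ i)"
    if t: "t \<in> T" "z \<in> B t" "w \<in> B t" for t z w
  proof (cases "fst t")
    case True
    thus ?thesis using t V_orbit[of z "snd t" w] by (auto simp: B_def split: prod.splits)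
  next
    case False
    then obtain z' w' where zw: "z' \<in> V (snd t)" "w' \<in> V (snd t)" "z = - z'" "w = - w'"
      using t by (auto simp: B_def split: prod.splits)
    \<comment> \<open>Odd powers commute with negation, so orbits of negatives are negatives of
      orbits.\<close>
    have "odd (q ^ i)" for i using p_odd by simp
    moreover obtain i where "w' = z' ^ (q ^ i) \<or> w' = inverse z' ^ (q ^ i)"
      using V_orbit zw by blast
    ultimately show ?thesis using zw by (intro exI[of _ i]) auto
  qed
  have codes: "{C. cyclic_code N C \<and> LCD N C} =
      {code_gen N (\<Prod>t\<in>T. R t ^ \<epsilon> t) | \<epsilon>. \<forall>t\<in>T. \<epsilon> t \<in> {0, P}}"
    by (rule LCD_codes_of_blocks(1)[OF T cov disj ne ER inv orb])
  have "card {C :: 'a poly set. cyclic_code N C \<and> LCD N C} = 2 ^ card T"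
    by (rule LCD_codes_of_blocks(2)[OF T cov disj ne ER inv orb])
  moreover have "card T = 2 * card X" by (simp add: T_def card_cartesian_product)
  ultimately show "card {C :: 'a poly set. cyclic_code N C \<and> LCD N C} = 2 ^ (2 * card X)" by simp
  have prodT: "(\<Prod>t\<in>T. R t ^ \<epsilon> t) = (\<Prod>x\<in>X. Q x ^ \<epsilon> (True, x) * Q' x ^ \<epsilon> (False, x))" for \<epsilon>
  proof -
    have "(\<Prod>t\<in>T. R t ^ \<epsilon> t) = (\<Prod>b\<in>UNIV. \<Prod>x\<in>X. R (b, x) ^ \<epsilon> (b, x))"
      by (simp add: T_def prod.cartesian_product)
    thus ?thesis by (simp add: R_def UNIV_bool prod.distrib mult.commute)
  qed
  show "{C. cyclic_code N C \<and> LCD N C} =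
      {code_gen N (\<Prod>x\<in>X. Q x ^ \<epsilon> x * Q' x ^ \<sigma> x) | \<epsilon> \<sigma>. \<forall>x\<in>X. \<epsilon> x \<in> {0, P} \<and> \<sigma> x \<in> {0, P}}"
    (is "_ = ?gens")
  proof (unfold codes, intro equalityI subsetI)
    fix C assume "C \<in> {code_gen N (\<Prod>t\<in>T. R t ^ \<epsilon> t) | \<epsilon>. \<forall>t\<in>T. \<epsilon> t \<in> {0, P}}"
    then obtain \<epsilon> where "C = code_gen N (\<Prod>t\<in>T. R t ^ \<epsilon> t)" and \<epsilon>: "\<forall>t\<in>T. \<epsilon> t \<in> {0, P}" by blast
    hence "C = code_gen N (\<Prod>x\<in>X. Q x ^ \<epsilon> (True, x) * Q' x ^ \<epsilon> (False, x))" by (simp add: prodT)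
    moreover have "\<forall>x\<in>X. \<epsilon> (True, x) \<in> {0, P} \<and> \<epsilon> (False, x) \<in> {0, P}" using \<epsilon> by (simp add: T_def)
    ultimately show "C \<in> ?gens" unfolding mem_Collect_eq
      by (intro exI[of _ "\<lambda>x. \<epsilon> (True, x)"] exI[of _ "\<lambda>x. \<epsilon> (False, x)"] conjI)
  next
    fix C assume "C \<in> ?gens"
    then obtain \<epsilon> \<sigma> where C: "C = code_gen N (\<Prod>x\<in>X. Q x ^ \<epsilon> x * Q' x ^ \<sigma> x)"
      and es: "\<forall>x\<in>X. \<epsilon> x \<in> {0, P} \<and> \<sigma> x \<in> {0, P}" by blast
    let ?e = "\<lambda>(b, x). if b then \<epsilon> x else \<sigma> x"
    have "C = code_gen N (\<Prod>t\<in>T. R t ^ ?e t)" by (simp add: prodT C)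
    moreover have "\<forall>t\<in>T. ?e t \<in> {0, P}" using es by (auto simp: T_def)
    ultimately show "C \<in> {code_gen N (\<Prod>t\<in>T. R t ^ \<epsilon> t) | \<epsilon>. \<forall>t\<in>T. \<epsilon> t \<in> {0, P}}" by blast
  qed
qed

text \<open>Here -1 is a power of \<open>q\<close>, so every coset is closed under negation and each
  block comes from a single minimal polynomial.\<close>

lemma LCD_codes_even:
  assumes ev: "even (ord l q)"
    and e: "e + 1 = card {cyclo_coset q (l ^ m) t | t. True}"
    and distinct: "\<And>i j. i \<le> e \<Longrightarrow> j \<le> e \<Longrightarrow> i \<noteq> j \<Longrightarrow>
      cyclo_coset q (l ^ m) (\<rho> i) \<noteq> cyclo_coset q (l ^ m) (\<rho> j)"
  shows "{C. cyclic_code N C \<and> LCD N C} =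
      {code_gen N (\<Prod>i\<le>e. hatp (M (\<rho> i)) ^ \<epsilon> i * hatp (negX (M (\<rho> i))) ^ \<sigma> i)
        | \<epsilon> \<sigma>. \<forall>i\<le>e. \<epsilon> i \<in> {0, P} \<and> \<sigma> i \<in> {0, P}}"
    and "card {C :: 'a poly set. cyclic_code N C \<and> LCD N C} = 2 ^ (2 * (e + 1))"
proof -
  have "even (ord (l ^ m) q)" using ev ord_dvd_ord_power[OF m_pos, of l q] by (rule dvd_trans)
  from cong_minus_one_half_ord[OF l_prime l_odd q_cop this]
  have "[- t * - 1 = - t * int q ^ (ord (l ^ m) q div 2)] (mod int (l ^ m))" for t
    by (intro cong_scalar_left) (rule cong_sym)
  hence neg: "rel t (- t)" for t by (intro relI) simp
  have inj: "inj_on (\<lambda>i. cyclo_coset q (l ^ m) (\<rho> i)) {..e}"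
    by (rule inj_onI) (use distinct in blast)
  \<comment> \<open>The representatives give \<open>e + 1\<close> distinct cosets, which is their
    total number, so none is missed.\<close>
  have "(\<lambda>i. cyclo_coset q (l ^ m) (\<rho> i)) ` {..e} = {cyclo_coset q (l ^ m) t | t. True}"
  proof (rule card_subset_eq)
    show "finite {cyclo_coset q (l ^ m) t | t. True}"
      \<comment> \<open>An infinite set has \<open>card\<close> 0, which \<open>e + 1\<close> rules
        out.\<close>
      using e by (metis card.infinite add_is_0 one_neq_zero)
    show "card ((\<lambda>i. cyclo_coset q (l ^ m) (\<rho> i)) ` {..e}) = card {cyclo_coset q (l ^ m) t | t. True}"
      using card_image[OF inj] e by simp
  qed blast
  hence "\<exists>i\<in>{..e}. cyclo_coset q (l ^ m) t = cyclo_coset q (l ^ m) (\<rho> i)" for t by blast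
  hence cover: "\<exists>i\<in>{..e}. rel t (\<rho> i) \<or> rel t (- \<rho> i)" for t by (simp only: cyclo_coset_eq_iff) blast
  have uniq: "i = j" if "i \<in> {..e}" "j \<in> {..e}" "rel (\<rho> i) (\<rho> j) \<or> rel (\<rho> i) (- \<rho> j)" for i j
  proof -
    have "rel (\<rho> i) (\<rho> j)" using that(3) rel_trans[OF _ rel_sym[OF neg]] by blast
    thus ?thesis using distinct that by (auto simp: cyclo_coset_eq_iff[symmetric])
  qed
  have Z: "Z (\<rho> i) \<union> Z (- \<rho> i) = Z (\<rho> i)" for i using Z_eq[OF neg] by blast
  have Q: "E (hatp (M (\<rho> i))) = root_poly (Z (\<rho> i) \<union> Z (- \<rho> i))"
    and Q': "E (hatp (negX (M (\<rho> i)))) = root_poly (uminus ` (Z (\<rho> i) \<union> Z (- \<rho> i)))" for i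
    by (simp_all add: Z hatp_M E_M E_hatp_negX[OF E_M])
  show "{C. cyclic_code N C \<and> LCD N C} =
      {code_gen N (\<Prod>i\<le>e. hatp (M (\<rho> i)) ^ \<epsilon> i * hatp (negX (M (\<rho> i))) ^ \<sigma> i)
        | \<epsilon> \<sigma>. \<forall>i\<le>e. \<epsilon> i \<in> {0, P} \<and> \<sigma> i \<in> {0, P}}"
    unfolding atMost_iff[symmetric] Ball_def[symmetric]
    by (rule LCD_codes_of_representatives(1)[OF finite_atMost cover uniq Q Q'])
  have "card {C :: 'a poly set. cyclic_code N C \<and> LCD N C} = 2 ^ (2 * card {..e})"
    by (rule LCD_codes_of_representatives(2)[OF finite_atMost cover uniq Q Q'])
  thus "card {C :: 'a poly set. cyclic_code N C \<and> LCD N C} = 2 ^ (2 * (e + 1))" by simp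
qed

lemma Z_0: "Z 0 = {1}"
  by (auto simp: Z_def)

text \<open>A nonzero coset and its negative differ but form one inversion block, which is why their
  two minimal polynomials share an exponent.\<close>

lemma LCD_codes_odd:
  assumes od: "odd (ord l q)" and e: "e + 1 = card {cyclo_coset q (l ^ m) t | t. True}"
  shows "{C. cyclic_code N C \<and> LCD N C} =
      {code_gen N
         ([:-1, 1:] ^ a0 * [:1, 1:] ^ b0 *
          (\<Prod>r\<in>{1..m}. \<Prod>k<\<delta> r div 2.
             M (int (l ^ (m - r) * g ^ k)) ^ \<epsilon> r k
           * M (- int (l ^ (m - r) * g ^ k)) ^ \<epsilon> r k
           * hatp (negX (M (int (l ^ (m - r) * g ^ k)))) ^ \<sigma> r k
           * hatp (negX (M (- int (l ^ (m - r) * g ^ k)))) ^ \<sigma> r k))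
       | a0 b0 \<epsilon> \<sigma>. a0 \<in> {0, P} \<and> b0 \<in> {0, P} \<and>
           (\<forall>r\<in>{1..m}. \<forall>k<\<delta> r div 2. \<epsilon> r k \<in> {0, P} \<and> \<sigma> r k \<in> {0, P})}" (is "_ = ?gens")
    and "card {C :: 'a poly set. cyclic_code N C \<and> LCD N C} = 2 ^ (e + 2)"
proof -
  interpret prime_power_generator_odd l m q g by unfold_locales (rule od)
  \<comment> \<open>At level 0 both signs give the root set {1}, so the factor is X - 1 taken once,
    not a product of two minimal polynomials.\<close>
  define Q where "Q x = (if fst x = 0 then [:-1, 1:] else M (rep x) * M (- rep x))" for x
  define Q' where "Q' x = (if fst x = 0 then [:1, 1:] else
    hatp (negX (M (rep x))) * hatp (negX (M (- rep x))))" for x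
  have Zx: "Z (rep x) \<union> Z (- rep x) = {1}" if "fst x = 0" for x
    using that Z_0 by (cases x) (simp add: rep_def)
  have Z_disj: "Z (rep x) \<inter> Z (- rep x) = {}" if "x \<in> idx" "fst x \<noteq> 0" for x
  proof (rule ccontr)
    assume "Z (rep x) \<inter> Z (- rep x) \<noteq> {}"
    then obtain t where "\<eta> powi t \<in> Z (rep x)" "\<eta> powi t \<in> Z (- rep x)" by (auto simp: Z_def)
    hence "rel (rep x) (- rep x)" using powi_in_Z rel_sym rel_trans by blast
    thus False using rep_not_rel_minus[OF that(1)] that(2) by (metis fst_conv)
  qed
  have EQ: "E (Q x) = root_poly (Z (rep x) \<union> Z (- rep x))" if "x \<in> idx" for x
  proof (cases "fst x = 0")
    case True
    thus ?thesis by (simp add: Q_def Zx root_poly_def map_poly_pCons emb_hom emb_uminus)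
  next
    case False
    thus ?thesis using root_poly_Un[OF finite_Z finite_Z Z_disj[OF that False]]
      by (simp add: Q_def E_mult E_M)
  qed
  have EQ': "E (Q' x) = root_poly (uminus ` (Z (rep x) \<union> Z (- rep x)))" if "x \<in> idx" for x
  proof (cases "fst x = 0")
    case True
    thus ?thesis by (simp add: Q'_def Zx root_poly_def map_poly_pCons emb_hom emb_uminus)
  next
    case False
    have "uminus ` Z (rep x) \<inter> uminus ` Z (- rep x) = {}" using Z_disj[OF that False] by auto
    thus ?thesis using False
      by (simp add: Q'_def E_mult E_hatp_negX[OF E_M] image_Un root_poly_Un finite_Z)
  qed
  have cover: "\<exists>x\<in>idx. rel t (rep x) \<or> rel t (- rep x)" for t using rep_cover by metis
  have codes: "{C. cyclic_code N C \<and> LCD N C} = {code_gen N (\<Prod>x\<in>idx. Q x ^ \<epsilon> x * Q' x ^ \<sigma> x)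
      | \<epsilon> \<sigma>. \<forall>x\<in>idx. \<epsilon> x \<in> {0, P} \<and> \<sigma> x \<in> {0, P}}"
    by (rule LCD_codes_of_representatives(1)[OF finite_idx cover rep_unique EQ EQ'])
  have "card {C :: 'a poly set. cyclic_code N C \<and> LCD N C} = 2 ^ (2 * card idx)"
    by (rule LCD_codes_of_representatives(2)[OF finite_idx cover rep_unique EQ EQ'])
  thus "card {C :: 'a poly set. cyclic_code N C \<and> LCD N C} = 2 ^ (e + 2)"
    using card_cosets e by simp
  define F where "F = (\<lambda>\<epsilon> \<sigma> r k. M (int (l ^ (m - r) * g ^ k)) ^ \<epsilon>
           * M (- int (l ^ (m - r) * g ^ k)) ^ \<epsilon>
           * hatp (negX (M (int (l ^ (m - r) * g ^ k)))) ^ \<sigma>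
           * hatp (negX (M (- int (l ^ (m - r) * g ^ k)))) ^ (\<sigma>::nat))"
  have prod_idx: "(\<Prod>x\<in>idx. Q x ^ \<epsilon> x * Q' x ^ \<sigma> x) =
      [:-1, 1:] ^ \<epsilon> (0, 0) * [:1, 1:] ^ \<sigma> (0, 0) *
      (\<Prod>r\<in>{1..m}. \<Prod>k<\<delta> r div 2. F (\<epsilon> (r, k)) (\<sigma> (r, k)) r k)" for \<epsilon> \<sigma>
  proof -
    let ?f = "\<lambda>r k. Q (r, k) ^ \<epsilon> (r, k) * Q' (r, k) ^ \<sigma> (r, k)"
    let ?K = "\<lambda>r. if r = 0 then {0} else {..<\<delta> r div 2}"
    have "(\<Prod>x\<in>idx. Q x ^ \<epsilon> x * Q' x ^ \<sigma> x) = (\<Prod>r\<in>{0..m}. \<Prod>k\<in>?K r. ?f r k)"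
      unfolding idx_def by (subst prod.Sigma) (auto intro!: prod.cong)
    also have "{0..m} = insert 0 {1..m}" by auto
    also have "(\<Prod>r\<in>insert 0 {1..m}. \<Prod>k\<in>?K r. ?f r k) = ?f 0 0 * (\<Prod>r\<in>{1..m}. \<Prod>k\<in>?K r. ?f r k)"
      by (subst prod.insert) auto
    also have "(\<Prod>r\<in>{1..m}. \<Prod>k\<in>?K r. ?f r k) =
        (\<Prod>r\<in>{1..m}. \<Prod>k<\<delta> r div 2. F (\<epsilon> (r, k)) (\<sigma> (r, k)) r k)"
      by (intro prod.cong) (auto simp: F_def Q_def Q'_def rep_def power_mult_distrib ac_simps)
    finally show ?thesis by (simp add: Q_def Q'_def)
  qed
  have gens: "?gens = {code_gen N ([:-1, 1:] ^ a0 * [:1, 1:] ^ b0 *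
      (\<Prod>r\<in>{1..m}. \<Prod>k<\<delta> r div 2. F (\<epsilon> r k) (\<sigma> r k) r k))
       | a0 b0 \<epsilon> \<sigma>. a0 \<in> {0, P} \<and> b0 \<in> {0, P} \<and>
           (\<forall>r\<in>{1..m}. \<forall>k<\<delta> r div 2. \<epsilon> r k \<in> {0, P} \<and> \<sigma> r k \<in> {0, P})}" (is "_ = ?gens'")
    by (simp only: F_def)
  \<comment> \<open>Separates the exponents of X - 1 and X + 1, stored at \<open>(0, 0)\<close>,
    from those of the double product.\<close>
  have idx_all: "(\<forall>x\<in>idx. R x) \<longleftrightarrow> R (0, 0) \<and> (\<forall>r\<in>{1..m}. \<forall>k<\<delta> r div 2. R (r, k))" for R
  proof -
    have "x \<in> idx \<longleftrightarrow> x = (0, 0) \<or> (\<exists>r\<in>{1..m}. \<exists>k<\<delta> r div 2. x = (r, k))" for x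
      by (cases x) (auto simp: idx_def)
    thus ?thesis by auto
  qed
  show "{C. cyclic_code N C \<and> LCD N C} = ?gens"
  proof (unfold codes gens, intro equalityI subsetI)
    fix C assume "C \<in> {code_gen N (\<Prod>x\<in>idx. Q x ^ \<epsilon> x * Q' x ^ \<sigma> x)
      | \<epsilon> \<sigma>. \<forall>x\<in>idx. \<epsilon> x \<in> {0, P} \<and> \<sigma> x \<in> {0, P}}"
    then obtain \<epsilon> \<sigma> where C: "C = code_gen N (\<Prod>x\<in>idx. Q x ^ \<epsilon> x * Q' x ^ \<sigma> x)"
      and es: "\<forall>x\<in>idx. \<epsilon> x \<in> {0, P} \<and> \<sigma> x \<in> {0, P}" by blast
    show "C \<in> ?gens'" unfolding C prod_idx mem_Collect_eq
      by (rule exI[of _ "\<epsilon> (0, 0)"], rule exI[of _ "\<sigma> (0, 0)"],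
          rule exI[of _ "\<lambda>r k. \<epsilon> (r, k)"], rule exI[of _ "\<lambda>r k. \<sigma> (r, k)"])
        (use es in \<open>unfold idx_all, blast\<close>)
  next
    fix C assume "C \<in> ?gens'"
    then obtain a0 b0 \<epsilon> \<sigma> where C: "C = code_gen N ([:-1, 1:] ^ a0 * [:1, 1:] ^ b0 *
        (\<Prod>r\<in>{1..m}. \<Prod>k<\<delta> r div 2. F (\<epsilon> r k) (\<sigma> r k) r k))"
      and es: "a0 \<in> {0, P}" "b0 \<in> {0, P}"
        "\<forall>r\<in>{1..m}. \<forall>k<\<delta> r div 2. \<epsilon> r k \<in> {0, P} \<and> \<sigma> r k \<in> {0, P}" by blast
    define \<epsilon>' where "\<epsilon>' = (\<lambda>(r, k). if r = 0 then a0 else \<epsilon> r k)"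
    define \<sigma>' where "\<sigma>' = (\<lambda>(r, k). if r = 0 then b0 else \<sigma> r k)"
    have "C = code_gen N (\<Prod>x\<in>idx. Q x ^ \<epsilon>' x * Q' x ^ \<sigma>' x)"
      unfolding C prod_idx by (auto simp: \<epsilon>'_def \<sigma>'_def intro!: arg_cong[of _ _ "code_gen N"] prod.cong)
    moreover have "\<forall>x\<in>idx. \<epsilon>' x \<in> {0, P} \<and> \<sigma>' x \<in> {0, P}"
      unfolding idx_all using es by (simp add: \<epsilon>'_def \<sigma>'_def)
    ultimately show "C \<in> {code_gen N (\<Prod>x\<in>idx. Q x ^ \<epsilon> x * Q' x ^ \<sigma> x)
      | \<epsilon> \<sigma>. \<forall>x\<in>idx. \<epsilon> x \<in> {0, P} \<and> \<sigma> x \<in> {0, P}}" by blast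
  qed
qed

end

theorem theorem4p4:
  fixes p s l m n :: nat
    and emb :: "'a::{field,finite} \<Rightarrow> 'b::field"
    and \<eta> :: 'b
    and g :: nat
    and \<rho> :: "nat \<Rightarrow> int"
    and e :: nat
  defines "q \<equiv> p ^ s"
  defines "N \<equiv> 2 * l ^ m * p ^ n"
  defines "M \<equiv> minpoly_M emb \<eta> q (l ^ m)"
  defines "f \<equiv> ord l q"
  defines "lam \<equiv> (\<lambda>r::nat. ord (l ^ r) q)"
  defines "\<delta> \<equiv> (\<lambda>r::nat. totient (l ^ r) div lam r)"
  defines "LCDs \<equiv> {C :: 'a poly set. cyclic_code N C \<and> LCD N C}"
  assumes p_prime: "prime p" and p_odd: "odd p"
    and s_pos: "s > 0" and card_F: "card (UNIV :: 'a set) = q"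
    and l_prime: "prime l" and l_odd: "odd l" and l_ne_p: "l \<noteq> p"
    and m_pos: "m > 0" and n_pos: "n > 0"
    and emb_hom: "emb 0 = 0" "emb 1 = 1" "\<And>x y. emb (x + y) = emb x + emb y"
                 "\<And>x y. emb (x * y) = emb x * emb y"
    and eta_prim: "\<eta> ^ (l ^ m) = 1" "\<And>j. 0 < j \<Longrightarrow> j < l ^ m \<Longrightarrow> \<eta> ^ j \<noteq> 1"
    and g_gen: "coprime g l" "ord (l ^ m) g = totient (l ^ m)"
    and e_def: "e + 1 = card {cyclo_coset q (l ^ m) t | t. True}"
    and rho0: "\<rho> 0 = 0"
    and rho_distinct: "\<And>i j. i \<le> e \<Longrightarrow> j \<le> e \<Longrightarrow> i \<noteq> j \<Longrightarrow>
                         cyclo_coset q (l ^ m) (\<rho> i) \<noteq> cyclo_coset q (l ^ m) (\<rho> j)"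
  shows
   "(odd f \<longrightarrow>
      LCDs = {code_gen N
               ([:-1, 1:] ^ a0 * [:1, 1:] ^ b0 *
                (\<Prod>r\<in>{1..m}. \<Prod>k<\<delta> r div 2.
                   M (int (l ^ (m - r) * g ^ k)) ^ \<epsilon> r k
                 * M (- int (l ^ (m - r) * g ^ k)) ^ \<epsilon> r k
                 * hatp (negX (M (int (l ^ (m - r) * g ^ k)))) ^ \<sigma> r k
                 * hatp (negX (M (- int (l ^ (m - r) * g ^ k)))) ^ \<sigma> r k))
             | a0 b0 \<epsilon> \<sigma>. a0 \<in> {0, p ^ n} \<and> b0 \<in> {0, p ^ n} \<and>
                 (\<forall>r\<in>{1..m}. \<forall>k<\<delta> r div 2. \<epsilon> r k \<in> {0, p ^ n} \<and> \<sigma> r k \<in> {0, p ^ n})}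
      \<and> card LCDs = 2 ^ (e + 2))
  \<and> (even f \<longrightarrow>
      LCDs = {code_gen N
               (\<Prod>i\<le>e. hatp (M (\<rho> i)) ^ \<epsilon> i * hatp (negX (M (\<rho> i))) ^ \<sigma> i)
             | \<epsilon> \<sigma>. \<forall>i\<le>e. \<epsilon> i \<in> {0, p ^ n} \<and> \<sigma> i \<in> {0, p ^ n}}
      \<and> card LCDs = 2 ^ (2 * (e + 1)))"
proof -
  have "coprime p l" using primes_coprime p_prime l_prime l_ne_p by metis
  hence "coprime (p ^ s) l" by simp
  then interpret R: prime_power_roots emb p s l m g \<eta> n
    using p_prime p_odd s_pos card_F l_prime l_odd m_pos emb_hom eta_prim g_gen
    unfolding q_def by unfold_locales
  have \<delta>: "\<delta> = R.\<delta>" by (simp add: \<delta>_def R.\<delta>_def lam_def q_def fun_eq_iff)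
  show ?thesis
    unfolding LCDs_def N_def M_def \<delta> f_def q_def
    using R.LCD_codes_odd[OF _ e_def[unfolded q_def]]
      R.LCD_codes_even[OF _ e_def[unfolded q_def] rho_distinct[unfolded q_def]] by simp
qed

end
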